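(* Let $\alpha$ be a badly approximable irrational, and let $f(x)=I_{[a,b]}(\{x\})-(b-a)$ with an interval $[a,b]\subset[0,1]$ of length $0<b-a<1$ such that \[ \inf_{q\in\mathbb{Z}\setminus\{0\}}|q|\cdot\|q\alpha-k(b-a)\|>0\quad\text{for all }k\in\{1,3,5,7,9\}. \] Let $S_N(\alpha,f)=\sum_{n=1}^Nf(n\alpha)$, $A_M=\frac1M\sum_{N=1}^MS_N(\alpha,f)$ and $B_M^2=\frac1M\sum_{N=1}^M(S_N(\alpha,f)-A_M)^2$. Then for all integers $M\ge 2$, \[ \log M\ll B_M^2\ll\log M \] with implied (positive) constants depending only on $\alpha$ and $b-a$.
   Context: $\|\cdot\|$ denotes the distance from the nearest integer, $\{\cdot\}$ the fractional part, and $I_{[a,b]}$ the indicator function of $[a,b]$. An irrational $\alpha$ is badly approximable if $\inf_{q\ge1}q\|q\alpha\|>0$, where $q$ ranges over positive integers. $X\ll Y$ means $|X|\le CY$ with an implied constant $C>0$. *)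

theory Defs
  imports Complex_Main "HOL-Library.Indicator_Function"
begin

definition dist_nearest_int :: "real \<Rightarrow> real" where
  "dist_nearest_int x = \<bar>x - of_int (round x)\<bar>"

text \<open>The infima below range over nonempty sets of nonnegative reals, so the real-valued
  infimum is the true one.\<close>

definition badly_approximable :: "real \<Rightarrow> bool" where
  "badly_approximable \<alpha> \<longleftrightarrow>
     \<alpha> \<notin> \<rat> \<and> (INF q\<in>{q::nat. q \<ge> 1}. real q * dist_nearest_int (real q * \<alpha>)) > 0"

definition interval_discrepancy_fun :: "real \<Rightarrow> real \<Rightarrow> real \<Rightarrow> real" where
  "interval_discrepancy_fun a b x = indicator {a..b} (frac x) - (b - a)"

definition birkhoff_sum :: "real \<Rightarrow> (real \<Rightarrow> real) \<Rightarrow> nat \<Rightarrow> real" where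
  "birkhoff_sum \<alpha> f N = (\<Sum>n=1..N. f (real n * \<alpha>))"

definition birkhoff_mean :: "real \<Rightarrow> (real \<Rightarrow> real) \<Rightarrow> nat \<Rightarrow> real" where
  "birkhoff_mean \<alpha> f M = 1 / real M * (\<Sum>N=1..M. birkhoff_sum \<alpha> f N)"

text \<open>The quantity \<open>B\<^sub>M\<^sup>2\<close>, square included.\<close>

definition birkhoff_variance :: "real \<Rightarrow> (real \<Rightarrow> real) \<Rightarrow> nat \<Rightarrow> real" where
  "birkhoff_variance \<alpha> f M =
     1 / real M * (\<Sum>N=1..M. (birkhoff_sum \<alpha> f N - birkhoff_mean \<alpha> f M)\<^sup>2)"

end

theory Submission
  imports Defs "HOL-Analysis.Kronecker_Approximation_Theorem"
begin

text \<open>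
  The proof replaces the rotation by \<open>\<alpha>\<close> by a rational rotation and computes the variance there
  exactly. Write \<open>\<parallel>x\<parallel>\<close> for the distance to the nearest integer, \<open>L = b - a\<close>, and let
  \<open>\<parallel>n \<alpha>\<parallel> \<ge> c / |n|\<close> for all \<open>n \<noteq> 0\<close>.

  Let \<open>p / q\<close> be a reduced fraction with \<open>|q \<alpha> - p| \<le> 1 / q\<close>. For \<open>n \<le> q\<close> the points \<open>n \<alpha>\<close> and
  \<open>n p / q\<close> are within \<open>1 / q\<close> of each other, and the points \<open>n \<alpha>\<close> are separated by at least \<open>c / q\<close>,
  so replacing \<open>\<alpha>\<close> by \<open>p / q\<close> and \<open>[a, b]\<close> by an interval of \<open>l = \<lfloor>L q\<rfloor>\<close> residues modulo \<open>q\<close> changes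
  only boundedly many terms of each Birkhoff sum (\<open>birkhoff_sum_close\<close>). The modified sums \<open>T\<^sub>N\<close>
  are \<open>q\<close>-periodic in \<open>N\<close>. By summation by parts the Fourier coefficient of \<open>T\<close> at the frequency
  \<open>m p\<close> is the geometric sum over the \<open>l\<close> residues divided by \<open>e(m p / q) - 1\<close>, up to a factor of
  absolute value 1, and Parseval's identity gives, for the mean \<open>\<mu>\<close> of \<open>T\<close>
  (\<open>arc_discrepancy_variance\<close>),
  \<open>\<Sum>\<^sub>N (T\<^sub>N - \<mu>)\<^sup>2 = (1 / q) \<Sum>\<^sub>m |e(m l / q) - 1|\<^sup>2 / (|e(m / q) - 1|\<^sup>2 |e(m p / q) - 1|\<^sup>2)\<close>,
  where \<open>N\<close> runs over \<open>1, \<dots>, q\<close> and \<open>m\<close> over \<open>1, \<dots>, q - 1\<close>. So the variance over a full period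
  is comparable with \<open>\<Sum>\<^sub>m \<parallel>m l / q\<parallel>\<^sup>2 / (q\<^sup>2 \<parallel>m / q\<parallel>\<^sup>2 \<parallel>m p / q\<parallel>\<^sup>2)\<close>.

  Dirichlet's theorem provides such a \<open>q\<close> with \<open>q \<le> Q\<close> for every \<open>Q\<close>, and bad approximability forces
  \<open>q \<ge> c Q\<close>. All summands of the variance are nonnegative, so averages over \<open>N \<le> M\<close> can be compared with
  full periods: \<open>M \<le> q \<lless> M\<close> serves the upper bound, \<open>c M \<le> q \<le> M\<close> the lower bound.

  Upper bound: the points \<open>m p / q\<close> with \<open>m \<le> Y\<close> are separated by \<open>\<ggreater> 1 / Y\<close> and stay away from 0 by the
  same amount, hence \<open>\<Sum> 1 / \<parallel>m p / q\<parallel>\<^sup>2 \<lless> Y\<^sup>2\<close> over \<open>m \<le> Y\<close>, and the sum weighted by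
  \<open>1 / m\<^sup>2\<close> is \<open>\<lless> log q\<close> (\<open>sum_inverse_dist_products_le\<close>).

  Lower bound: it suffices to find, at each of the \<open>\<ggreater> log q\<close> many geometric scales below \<open>q\<close>, one \<open>m\<close>
  for which \<open>m \<parallel>m \<alpha>\<parallel>\<close> is bounded above and \<open>\<parallel>m L\<parallel>\<close> is bounded below, since each contributes a
  constant. Two denominators of one scale that form a unimodular pair are candidates; if \<open>\<parallel>m L\<parallel>\<close> were
  small for both, then \<open>L\<close> would be so close to an integer combination \<open>n \<alpha> + l\<close> that the hypothesis on
  \<open>|n| \<parallel>n \<alpha> - L\<parallel>\<close> fails (\<open>exists_resonant_multiple\<close>).
\<close>

section \<open>Distance to the nearest integer and bad approximability\<close>

lemma dist_nearest_int_nonneg [simp]: "0 \<le> dist_nearest_int x"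
  by (simp add: dist_nearest_int_def)

lemma dist_nearest_int_le: "dist_nearest_int x \<le> \<bar>x - of_int k\<bar>"
  unfolding dist_nearest_int_def by (rule round_diff_minimal)

lemma dist_nearest_int_le_half: "dist_nearest_int x \<le> 1 / 2"
  unfolding dist_nearest_int_def using of_int_round_abs_le[of x] by (simp add: abs_minus_commute)

lemma dist_nearest_int_lipschitz: "dist_nearest_int x \<le> dist_nearest_int y + \<bar>x - y\<bar>"
  using dist_nearest_int_le[of x "round y"] unfolding dist_nearest_int_def by linarith

lemma dist_nearest_int_minus [simp]: "dist_nearest_int (- x) = dist_nearest_int x"
proof -
  have "dist_nearest_int (- y) \<le> dist_nearest_int y" for y
    using dist_nearest_int_le[of "- y" "- round y"] by (simp add: dist_nearest_int_def)
  from this[of x] this[of "- x"] show ?thesis by simp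
qed

lemma dist_nearest_int_add_int [simp]: "dist_nearest_int (x + of_int k) = dist_nearest_int x"
proof -
  have *: "dist_nearest_int (y + of_int j) \<le> dist_nearest_int y" for y j
    using dist_nearest_int_le[of "y + of_int j" "round y + j"] by (simp add: dist_nearest_int_def)
  from *[of x k] *[of "x + of_int k" "- k"] show ?thesis by simp
qed

lemma dist_nearest_int_triangle: "dist_nearest_int (x - y) \<le> dist_nearest_int x + dist_nearest_int y"
  using dist_nearest_int_le[of "x - y" "round x - round y"] unfolding dist_nearest_int_def by simp

lemma INF_pos_lower_bound:
  fixes f :: "'a \<Rightarrow> real"
  assumes "(INF q\<in>A. f q) > 0" "\<And>q. q \<in> A \<Longrightarrow> f q \<ge> 0"
  obtains c where "c > 0" "\<And>q. q \<in> A \<Longrightarrow> c \<le> f q"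
proof -
  have "bdd_below (f ` A)"
    using assms(2) by (intro bdd_belowI2[of _ 0]) auto
  then have "(INF q\<in>A. f q) \<le> f q" if "q \<in> A" for q
    using that by (rule cINF_lower)
  with assms(1) show ?thesis by (rule that)
qed

lemma badly_approximable_bound:
  assumes "badly_approximable \<alpha>"
  obtains c where "0 < c" "c \<le> 1 / 2"
    "\<And>n::int. n \<noteq> 0 \<Longrightarrow> c \<le> \<bar>of_int n\<bar> * dist_nearest_int (of_int n * \<alpha>)"
proof -
  obtain c where c: "c > 0" "\<And>q. q \<in> {q::nat. q \<ge> 1} \<Longrightarrow> c \<le> real q * dist_nearest_int (real q * \<alpha>)"
    using assms unfolding badly_approximable_def by (auto elim: INF_pos_lower_bound)
  have "c \<le> 1 / 2"
    using c(2)[of 1] dist_nearest_int_le_half[of \<alpha>] by simp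
  moreover have "c \<le> \<bar>of_int n\<bar> * dist_nearest_int (of_int n * \<alpha>)" if "n \<noteq> 0" for n :: int
  proof (cases "n \<ge> 0")
    case True
    then show ?thesis using c(2)[of "nat n"] that by simp
  next
    case False
    then show ?thesis using c(2)[of "nat (- n)"] by simp
  qed
  ultimately show ?thesis using that c(1) by blast
qed

text \<open>Dirichlet's theorem bounds \<open>q\<close> by \<open>Q\<close>; bad approximability turns \<open>\<parallel>q \<alpha>\<parallel> \<le> 1 / Q\<close> into the
  reverse bound \<open>q \<ge> c Q\<close>. So denominators of reduced approximations occur at every scale, up to
  the constant \<open>c\<close>.\<close>

lemma Dirichlet_approx_badly:
  assumes bad: "\<And>n::int. n \<noteq> 0 \<Longrightarrow> c \<le> \<bar>of_int n\<bar> * dist_nearest_int (of_int n * \<alpha>)" and Q: "Q > 0"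
  obtains q :: nat and p :: int where "q > 0" "coprime p (int q)" "q \<le> Q" "c * real Q \<le> real q"
    "\<bar>real q * \<alpha> - of_int p\<bar> \<le> 1 / real Q" "\<bar>real q * \<alpha> - of_int p\<bar> \<le> 1 / real q"
proof -
  obtain p k where k: "coprime p k" "0 < k" "k \<le> int Q" "\<bar>of_int k * \<alpha> - of_int p\<bar> < 1 / real Q"
    using Dirichlet_approx_coprime[OF Q] by blast
  define q where "q = nat k"
  have q: "k = int q" "q > 0" "q \<le> Q" using k by (auto simp: q_def)
  have "c \<le> real q * dist_nearest_int (real q * \<alpha>)"
    using bad[of "int q"] q by simp
  also have "\<dots> \<le> real q * (1 / real Q)"
    using dist_nearest_int_le[of "real q * \<alpha>" p] k q by (intro mult_left_mono) auto
  finally have "c * real Q \<le> real q" using Q by (simp add: field_simps)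
  moreover have "1 / real Q \<le> 1 / real q" using q by (simp add: frac_le)
  ultimately show ?thesis using that[of q p] k q by auto
qed

lemma mult_rational_approx:
  assumes "q > 0" "\<bar>real q * \<alpha> - of_int p\<bar> \<le> 1 / real q"
  shows "\<bar>real m * \<alpha> - real m * of_int p / real q\<bar> \<le> real m / (real q)\<^sup>2"
proof -
  have "real m * \<alpha> - real m * of_int p / real q = real m / real q * (real q * \<alpha> - of_int p)"
    using assms by (simp add: field_simps)
  then have "\<bar>real m * \<alpha> - real m * of_int p / real q\<bar> = real m / real q * \<bar>real q * \<alpha> - of_int p\<bar>"
    by (simp only: abs_mult) simp
  also have "\<dots> \<le> real m / real q * (1 / real q)"
    using assms by (intro mult_left_mono) auto
  finally show ?thesis by (simp add: power2_eq_square)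
qed

section \<open>Additive characters\<close>

text \<open>The standard character of the circle, kept opaque so that the simplifier does not rearrange the
  arguments of \<open>cis\<close>.\<close>

definition e :: "real \<Rightarrow> complex" where "e x = cis (2 * pi * x)"

lemma norm_e [simp]: "cmod (e x) = 1"
  by (simp add: e_def)

lemma e_0 [simp]: "e 0 = 1"
  by (simp add: e_def)

lemma e_add: "e (x + y) = e x * e y"
  by (simp add: e_def cis_mult algebra_simps)

lemma e_of_int [simp]: "e (of_int k) = 1"
  by (simp add: e_def complex_eq_iff cos_int_2pin sin_int_2pin)

lemma e_power: "e x ^ n = e (of_nat n * x)"
  by (simp add: e_def Complex.DeMoivre mult_ac)

lemma cnj_e: "cnj (e x) = e (- x)"
  by (simp add: e_def cis_cnj)

lemma e_cong_int:
  assumes "x - y = of_int k"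
  shows "e x = e y"
proof -
  from assms have "x = y + of_int k" by simp
  then show ?thesis by (simp only: e_add e_of_int mult_1_right)
qed

text \<open>A chord of the unit circle is comparable with the arc it spans; this turns denominators such as
  \<open>e x - 1\<close> into distances to the nearest integer.\<close>

lemma dist_nearest_int_chord:
  "2 * dist_nearest_int x \<le> cmod (e x - 1)" "cmod (e x - 1) \<le> 7 * dist_nearest_int x"
proof -
  (* The signed distance of x to the nearest integer; the chord depends on it alone. *)
  define u where "u = x - of_int (round x)"
  have d: "dist_nearest_int x = \<bar>u\<bar>" and u: "\<bar>u\<bar> \<le> 1 / 2"
    using dist_nearest_int_le_half[of x] by (simp_all add: dist_nearest_int_def u_def)
  have "e x = e u"
    by (rule e_cong_int[of _ _ "round x"]) (simp add: u_def)
  moreover have "(cmod (e u - 1))\<^sup>2 = (2 * \<bar>sin (pi * u)\<bar>)\<^sup>2"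
  proof -
    have "(cmod (e u - 1))\<^sup>2 = (cos (2 * (pi * u)) - 1)\<^sup>2 + (sin (2 * (pi * u)))\<^sup>2"
      by (simp add: e_def cmod_power2 mult.assoc)
    also have "\<dots> = 2 - 2 * cos (2 * (pi * u))"
      using sin_cos_squared_add[of "2 * (pi * u)"] by (simp add: power2_eq_square algebra_simps)
    also have "\<dots> = (2 * \<bar>sin (pi * u)\<bar>)\<^sup>2"
      by (simp only: cos_double_sin) (simp add: power_mult_distrib)
    finally show ?thesis .
  qed
  ultimately have c: "cmod (e x - 1) = 2 * \<bar>sin (pi * u)\<bar>"
    by (metis abs_ge_zero mult_nonneg_nonneg norm_ge_zero power2_eq_imp_eq zero_le_numeral)
  have "\<bar>sin (pi * u)\<bar> \<le> pi * \<bar>u\<bar>"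
    using abs_sin_x_le_abs_x[of "pi * u"] by (simp add: abs_mult)
  moreover have "pi * \<bar>u\<bar> \<le> (7/2) * \<bar>u\<bar>"
    using pi_less_4 pi_approx(2) by (intro mult_right_mono) auto
  ultimately show "cmod (e x - 1) \<le> 7 * dist_nearest_int x"
    using c d by linarith
  define z where "z = pi * \<bar>u\<bar> / 2"
  have z: "0 \<le> z" "z \<le> pi / 4"
    using u by (auto simp: z_def field_simps)
  \<comment> \<open>\<open>sin 2z = 2 tan z cos\<^sup>2 z \<ge> z\<close>, because \<open>tan z \<ge> z\<close> and \<open>cos\<^sup>2 z \<ge> 1/2\<close> for \<open>z \<le> \<pi>/4\<close>.\<close>
  have "z \<le> sin (2 * z)"
  proof -
    have "z < pi / 2" using z pi_gt_zero by linarith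
    then have tan: "z \<le> tan z"
      using abs_tan_ge[of z] tan_pos_pi2_le[of z] z by auto
    have "cos (pi / 4) \<le> cos z"
      using z by (intro cos_monotone_0_pi_le) auto
    then have cos: "sqrt 2 / 2 \<le> cos z" by (simp add: cos_45)
    then have cos0: "cos z > 0" by (rule less_le_trans[rotated]) simp
    have "(sqrt 2 / 2)\<^sup>2 \<le> (cos z)\<^sup>2"
      using cos by (intro power_mono) auto
    then have "1 / 2 \<le> (cos z)\<^sup>2" by (simp add: power_divide)
    then have "z * (2 * (1 / 2)) \<le> tan z * (2 * (cos z)\<^sup>2)"
      using tan z by (intro mult_mono) auto
    also have "\<dots> = sin (2 * z)"
      using cos0 by (simp add: tan_def sin_double power2_eq_square)
    finally show ?thesis by simp
  qed
  also have "sin (2 * z) \<le> \<bar>sin (pi * u)\<bar>"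
    by (cases "u \<ge> 0") (auto simp: z_def)
  finally have "pi * \<bar>u\<bar> / 2 \<le> \<bar>sin (pi * u)\<bar>" by (simp add: z_def)
  moreover have "2 * \<bar>u\<bar> \<le> pi * \<bar>u\<bar>"
    using pi_gt3 by (intro mult_right_mono) auto
  ultimately show "2 * dist_nearest_int x \<le> cmod (e x - 1)"
    using c d by linarith
qed

lemma e_eq_1_iff: "e x = 1 \<longleftrightarrow> x \<in> \<int>"
proof
  assume "e x = 1"
  then have "dist_nearest_int x = 0"
    using dist_nearest_int_chord(1)[of x] dist_nearest_int_nonneg[of x] by simp
  then show "x \<in> \<int>"
    unfolding dist_nearest_int_def by (metis Ints_of_int abs_0_eq eq_iff_diff_eq_0)
next
  assume "x \<in> \<int>"
  then show "e x = 1" by (auto elim!: Ints_cases)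
qed

lemma of_int_div_Ints_iff: "q > 0 \<Longrightarrow> real_of_int k / real q \<in> \<int> \<longleftrightarrow> int q dvd k"
proof
  assume q: "q > 0" and "real_of_int k / real q \<in> \<int>"
  then obtain j where "real_of_int k / real q = of_int j" by (auto elim!: Ints_cases)
  then have "real_of_int k = of_int (int q * j)" using q by (simp add: field_simps)
  then have "k = int q * j" by (simp only: of_int_eq_iff)
  then show "int q dvd k" by simp
qed auto

section \<open>Parseval's identity on a cyclic group\<close>

lemma sum_e_multiples:
  assumes "q > 0"
  shows "(\<Sum>t<q. e (real t * (of_int k / real q))) = (if int q dvd k then of_nat q else 0)"
proof -
  define z where "z = e (of_int k / real q)"
  have "(\<Sum>t<q. e (real t * (of_int k / real q))) = (\<Sum>t<q. z ^ t)"
    by (simp only: z_def e_power)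
  moreover have "z ^ q = 1"
    using assms by (simp add: z_def e_power)
  moreover have "z = 1 \<longleftrightarrow> int q dvd k"
    using assms by (simp add: z_def e_eq_1_iff of_int_div_Ints_iff)
  ultimately show ?thesis
    by (simp add: sum_gp_strict)
qed

text \<open>The sum over one full period of a nontrivial character vanishes. The index runs over \<open>1, \<dots>, q\<close>
  because Birkhoff sums start at 1.\<close>

lemma sum_e_powers_eq_0:
  assumes "e x \<noteq> 1" and "real q * x = of_int k"
  shows "(\<Sum>N=1..q. e x ^ N) = 0"
proof -
  have "(\<Sum>N=1..q. e x ^ N) = e x * (\<Sum>N<q. e x ^ N)"
    by (simp add: sum_distrib_left sum.atLeast1_atMost_eq)
  moreover have "e x ^ q = 1"
    by (simp add: e_power assms(2))
  ultimately show ?thesis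
    using assms(1) by (simp add: sum_gp_strict)
qed

lemma parseval_cyclic:
  fixes x :: "nat \<Rightarrow> complex"
  assumes "q > 0"
  shows "(\<Sum>t<q. (cmod (\<Sum>N=1..q. x N * e (- (real t * (real N / real q)))))\<^sup>2)
       = real q * (\<Sum>N=1..q. (cmod (x N))\<^sup>2)"
proof -
  have square: "complex_of_real ((cmod (\<Sum>N=1..q. x N * e (- (real t * (real N / real q)))))\<^sup>2)
     = (\<Sum>N=1..q. \<Sum>N'=1..q. x N * cnj (x N') * e (real t * (of_int (int N' - int N) / real q)))" for t
  proof -
    have "complex_of_real ((cmod (\<Sum>N=1..q. x N * e (- (real t * (real N / real q)))))\<^sup>2)
       = (\<Sum>N=1..q. x N * e (- (real t * (real N / real q)))) *
         (\<Sum>N=1..q. cnj (x N) * e (real t * (real N / real q)))"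
      by (simp only: complex_norm_square cnj_sum complex_cnj_mult cnj_e) (simp add: algebra_simps)
    also have "\<dots> = (\<Sum>N=1..q. \<Sum>N'=1..q. x N * cnj (x N') * (e (- (real t * (real N / real q))) * e (real t * (real N' / real q))))"
      by (simp add: sum_product mult_ac)
    also have "\<dots> = (\<Sum>N=1..q. \<Sum>N'=1..q. x N * cnj (x N') * e (real t * (of_int (int N' - int N) / real q)))"
      by (simp only: e_add[symmetric]) (simp add: algebra_simps diff_divide_distrib)
    finally show ?thesis .
  qed
  have "complex_of_real (\<Sum>t<q. (cmod (\<Sum>N=1..q. x N * e (- (real t * (real N / real q)))))\<^sup>2)
     = (\<Sum>t<q. \<Sum>N=1..q. \<Sum>N'=1..q. x N * cnj (x N') * e (real t * (of_int (int N' - int N) / real q)))"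
    unfolding of_real_sum square ..
  also have "\<dots> = (\<Sum>N=1..q. \<Sum>N'=1..q. \<Sum>t<q. x N * cnj (x N') * e (real t * (of_int (int N' - int N) / real q)))"
    by (subst sum.swap, rule sum.cong[OF refl], rule sum.swap)
  also have "\<dots> = (\<Sum>N=1..q. \<Sum>N'=1..q. x N * cnj (x N') * (if int q dvd int N' - int N then of_nat q else 0))"
    by (simp only: sum_distrib_left[symmetric] sum_e_multiples[OF assms])
  also have "\<dots> = (\<Sum>N=1..q. \<Sum>N'=1..q. if N' = N then x N * cnj (x N) * of_nat q else 0)"
  proof (intro sum.cong refl)
    fix N N' assume N: "N \<in> {1..q}" "N' \<in> {1..q}"
    have "int q dvd int N' - int N \<longleftrightarrow> N' = N"
    proof
      assume *: "int q dvd int N' - int N"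
      have "\<bar>int N' - int N\<bar> < int q" using N by auto
      with * have "int N' - int N = 0"
        using dvd_imp_le_int[of "int N' - int N" "int q"] by linarith
      then show "N' = N" by simp
    qed simp
    then show "x N * cnj (x N') * (if int q dvd int N' - int N then of_nat q else 0) = (if N' = N then x N * cnj (x N) * of_nat q else 0)"
      by simp
  qed
  also have "\<dots> = (\<Sum>N=1..q. x N * cnj (x N) * of_nat q)"
    by (intro sum.cong refl) (simp add: sum.delta)
  also have "\<dots> = complex_of_real (real q * (\<Sum>N=1..q. (cmod (x N))\<^sup>2))"
    by (simp add: complex_norm_square sum_distrib_left mult_ac flip: of_real_power)
  finally show ?thesis
    using of_real_eq_iff by blast
qed

text \<open>Parseval's identity for \<open>x - \<mu>\<close>: subtracting the mean removes exactly the frequency 0.\<close>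

lemma variance_cyclic:
  fixes x :: "nat \<Rightarrow> real"
  assumes "q > 0" and \<mu>: "\<mu> = (\<Sum>N=1..q. x N) / real q"
  shows "(\<Sum>N=1..q. (x N - \<mu>)\<^sup>2)
       = (\<Sum>t=1..<q. (cmod (\<Sum>N=1..q. of_real (x N) * e (- (real t * (real N / real q)))))\<^sup>2) / real q"
proof -
  let ?F = "\<lambda>y t. \<Sum>N=1..q. complex_of_real (y N) * e (- (real t * (real N / real q)))"
  define y where "y = (\<lambda>N. x N - \<mu>)"
  have F0: "?F y 0 = 0"
    using assms by (simp add: y_def sum_subtractf flip: of_real_sum)
  have Ft: "?F y t = ?F x t" if t: "t \<in> {1..<q}" for t
  proof -
    define z where "z = e (- (real t / real q))"
    have "z \<noteq> 1"
    proof -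
      have "\<not> int q dvd - int t"
        using t by (auto dest!: zdvd_imp_le)
      then show ?thesis
        using of_int_div_Ints_iff[of q "- int t"] assms by (simp add: z_def e_eq_1_iff)
    qed
    have "(\<Sum>N=1..q. e (- (real t * (real N / real q)))) = (\<Sum>N=1..q. z ^ N)"
      unfolding z_def e_power by (simp add: mult_ac)
    also have "\<dots> = 0"
      unfolding z_def by (rule sum_e_powers_eq_0[of _ _ "- int t"]) (use \<open>z \<noteq> 1\<close> assms in \<open>simp_all add: z_def\<close>)
    finally have "(\<Sum>N=1..q. complex_of_real \<mu> * e (- (real t * (real N / real q)))) = 0"
      by (simp flip: sum_distrib_left)
    then show ?thesis
      by (simp add: y_def left_diff_distrib sum_subtractf)
  qed
  have "real q * (\<Sum>N=1..q. (y N)\<^sup>2) = (\<Sum>t<q. (cmod (?F y t))\<^sup>2)"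
    using parseval_cyclic[OF assms(1), of "\<lambda>N. complex_of_real (y N)"] by simp
  also have "\<dots> = (\<Sum>t=1..<q. (cmod (?F y t))\<^sup>2)"
    using F0 assms by (simp add: lessThan_atLeast0 sum.atLeast_Suc_lessThan)
  also have "\<dots> = (\<Sum>t=1..<q. (cmod (?F x t))\<^sup>2)"
    using Ft by (intro sum.cong) auto
  finally show ?thesis
    unfolding y_def using assms(1) by (simp add: nonzero_eq_divide_eq mult.commute)
qed

section \<open>The exact variance for a rational rotation\<close>

text \<open>Whether the \<open>n\<close>-th point of the rotation by \<open>p\<close> modulo \<open>q\<close> lies in the arc of the \<open>l\<close> residues starting at
  \<open>A\<close>; its proportion in a full period is \<open>l / q\<close>.\<close>

definition arc_visit :: "nat \<Rightarrow> int \<Rightarrow> nat \<Rightarrow> nat \<Rightarrow> nat \<Rightarrow> real" where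
  "arc_visit q p A l n = of_bool (int n * p mod int q \<in> {int A..<int (A + l)})"

definition arc_discrepancy :: "nat \<Rightarrow> int \<Rightarrow> nat \<Rightarrow> nat \<Rightarrow> nat \<Rightarrow> real" where
  "arc_discrepancy q p A l N = (\<Sum>n=1..N. arc_visit q p A l n - real l / real q)"

lemma inj_on_mult_mod:
  assumes "q > 0" "coprime p (int q)" 
  shows "inj_on (\<lambda>n. int n * p mod int q) {1..q}"
proof (rule inj_onI)
  fix m n assume mn: "m \<in> {1..q}" "n \<in> {1..q}" and eq: "int m * p mod int q = int n * p mod int q"
  then have "int q dvd (int m - int n) * p"
    by (simp add: mod_eq_dvd_iff left_diff_distrib)
  then have "int q dvd int m - int n"
    using assms by (simp add: coprime_dvd_mult_left_iff coprime_commute)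
  moreover have "\<bar>int m - int n\<bar> < int q" using mn by auto
  ultimately have "int m - int n = 0"
    using dvd_imp_le_int[of "int m - int n" "int q"] by linarith
  then show "m = n" by simp
qed

lemma bij_betw_mult_mod:
  assumes "q > 0" "coprime p (int q)" 
  shows "bij_betw (\<lambda>n. int n * p mod int q) {1..q} {0..<int q}"
proof -
  have "(\<lambda>n. int n * p mod int q) ` {1..q} = {0..<int q}"
    using inj_on_mult_mod[OF assms] assms
    by (intro card_subset_eq) (auto simp: card_image)
  then show ?thesis
    using inj_on_mult_mod[OF assms] by (simp add: bij_betw_def)
qed

text \<open>Multiplication by \<open>p\<close> permutes the residues modulo \<open>q\<close>, so at the frequency \<open>m p\<close> the Fourier
  coefficient of the visits to the arc no longer depends on \<open>p\<close>.\<close>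

lemma sum_arc_visit:
  assumes "q > 0" "coprime p (int q)" "A + l \<le> q"
  shows "(\<Sum>n=1..q. of_real (arc_visit q p A l n) * e (- (real m * (of_int (int n * p) / real q))))
       = (\<Sum>r=A..<A+l. e (- (real m * (real r / real q))))"
proof -
  have "(\<Sum>n=1..q. of_real (arc_visit q p A l n) * e (- (real m * (of_int (int n * p) / real q))))
      = (\<Sum>n=1..q. (\<lambda>r. of_bool (r \<in> {int A..<int (A + l)}) * e (- (real m * (of_int r / real q)))) (int n * p mod int q))"
  proof (intro sum.cong refl)
    fix n
    let ?r = "int n * p mod int q"
    have "int n * p = int q * (int n * p div int q) + ?r" by simp
    then have "real_of_int (int n * p) = real q * of_int (int n * p div int q) + of_int ?r"
      by (metis of_int_add of_int_mult of_int_of_nat_eq)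
    then have "e (- (real m * (of_int (int n * p) / real q))) = e (- (real m * (of_int ?r / real q)))"
      using assms by (intro e_cong_int[of _ _ "- (int m * (int n * p div int q))"]) (simp add: field_simps)
    then show "of_real (arc_visit q p A l n) * e (- (real m * (of_int (int n * p) / real q)))
       = (\<lambda>r. of_bool (r \<in> {int A..<int (A + l)}) * e (- (real m * (of_int r / real q)))) (int n * p mod int q)"
      by (simp add: arc_visit_def)
  qed
  also have "\<dots> = (\<Sum>r\<in>{0..<int q}. of_bool (r \<in> {int A..<int (A + l)}) * e (- (real m * (of_int r / real q))))"
    by (rule sum.reindex_bij_betw[OF bij_betw_mult_mod[OF assms(1,2)]])
  also have "\<dots> = (\<Sum>r\<in>{int A..<int (A + l)}. e (- (real m * (of_int r / real q))))"
    using assms by (intro sum.mono_neutral_cong_right) auto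
  also have "\<dots> = (\<Sum>r\<in>int ` {A..<A+l}. e (- (real m * (of_int r / real q))))"
    by (simp add: image_int_atLeastLessThan)
  also have "\<dots> = (\<Sum>r=A..<A+l. e (- (real m * (real r / real q))))"
    by (subst sum.reindex) auto
  finally show ?thesis .
qed

lemma arc_discrepancy_0 [simp]: "arc_discrepancy q p A l 0 = 0"
  by (simp add: arc_discrepancy_def)

lemma arc_discrepancy_Suc:
  "arc_discrepancy q p A l (Suc N) = arc_discrepancy q p A l N + (arc_visit q p A l (Suc N) - real l / real q)"
  by (simp add: arc_discrepancy_def)

text \<open>One full period visits every residue once, so the discrepancy returns to 0; this is the boundary
  term in the summation by parts.\<close>

lemma arc_discrepancy_period:
  assumes "q > 0" "coprime p (int q)" "A + l \<le> q"
  shows "arc_discrepancy q p A l q = 0"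
proof -
  have "complex_of_real (\<Sum>n=1..q. arc_visit q p A l n) = complex_of_real (real l)"
    using sum_arc_visit[OF assms, of 0] by simp
  then have "(\<Sum>n=1..q. arc_visit q p A l n) = real l"
    using of_real_eq_iff by blast
  then show ?thesis
    using assms by (simp add: arc_discrepancy_def sum_subtractf)
qed

lemma summation_by_parts_cyclic:
  fixes T :: "nat \<Rightarrow> complex"
  assumes "T 0 = 0"
  shows "(\<Sum>n=1..q. (T n - T (n - 1)) * w ^ n) = (1 - w) * (\<Sum>n=1..q. T n * w ^ n) + T q * w ^ Suc q"
  using assms by (induction q) (auto simp: algebra_simps)

text \<open>A geometric sum, written without division so that it holds also when \<open>e (m / q) = 1\<close>.\<close>

lemma norm_sum_e_arc:
  assumes "q > 0"
  shows "cmod (\<Sum>r=A..<A+l. e (- (real m * (real r / real q)))) * cmod (e (real m / real q) - 1)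
    = cmod (e (real m * real l / real q) - 1)"
proof -
  define z where "z = e (- (real m / real q))"
  have conj: "cmod (e (- x) - 1) = cmod (e x - 1)" for x
    by (metis cnj_e complex_cnj_diff complex_cnj_one complex_mod_cnj)
  have "(\<Sum>r=A..<A+l. e (- (real m * (real r / real q)))) = (\<Sum>r=A..<A+l. z ^ r)"
    unfolding z_def e_power by (simp add: mult_ac)
  also have "\<dots> = z ^ A * (\<Sum>r<l. z ^ r)"
    using sum.shift_bounds_nat_ivl[of "\<lambda>r. z ^ r" 0 A l]
    by (simp add: sum_distrib_left power_add lessThan_atLeast0 add.commute mult.commute)
  finally have "(\<Sum>r=A..<A+l. e (- (real m * (real r / real q)))) * (z - 1) = z ^ A * ((z - 1) * (\<Sum>r<l. z ^ r))"
    by (simp add: mult_ac)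
  also have "(z - 1) * (\<Sum>r<l. z ^ r) = z ^ l - 1"
    by (metis power_diff_1_eq)
  finally have "cmod (\<Sum>r=A..<A+l. e (- (real m * (real r / real q)))) * cmod (z - 1) = cmod (z ^ A) * cmod (z ^ l - 1)"
    by (metis norm_mult)
  moreover have "cmod (z ^ A) = 1" by (simp add: z_def norm_power)
  moreover have "z ^ l = e (- (real m * real l / real q))"
    unfolding z_def e_power by (simp add: mult_ac)
  ultimately show ?thesis
    by (simp add: z_def conj)
qed

text \<open>The discrepancy is the sequence of partial sums of the centred visits, so its Fourier coefficient
  at \<open>m p\<close> is that of the visits, which is a geometric sum, divided by the factor \<open>1 - e (- m p / q)\<close>
  of the summation by parts. The frequencies \<open>m p\<close> exhaust all nonzero residues, and
  \<open>variance_cyclic\<close> adds up the squares.\<close>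

lemma arc_discrepancy_variance:
  assumes "q > 0" "coprime p (int q)" "A + l \<le> q"
    and \<mu>: "\<mu> = (\<Sum>N=1..q. arc_discrepancy q p A l N) / real q"
  shows "(\<Sum>N=1..q. (arc_discrepancy q p A l N - \<mu>)\<^sup>2)
       = (\<Sum>m=1..<q. (cmod (e (real m * real l / real q) - 1) /
            (cmod (e (real m / real q) - 1) * cmod (e (real m * of_int p / real q) - 1)))\<^sup>2) / real q"
proof -
  define F where "F = (\<lambda>t::int. \<Sum>N=1..q. complex_of_real (arc_discrepancy q p A l N) * e (- (of_int t * (real N / real q))))"
  have F_mod: "F (t mod int q) = F t" for t
  proof -
    have "t = int q * (t div int q) + t mod int q" by simp
    then have t: "real_of_int t = real q * of_int (t div int q) + of_int (t mod int q)"
      by (metis of_int_add of_int_mult of_int_of_nat_eq)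
    have "e (- (of_int (t mod int q) * (real N / real q))) = e (- (of_int t * (real N / real q)))" for N
      using assms by (intro e_cong_int[of _ _ "int N * (t div int q)"]) (simp add: t field_simps)
    then show ?thesis by (simp add: F_def)
  qed
  have F_eq: "(cmod (F (int m * p)))\<^sup>2 = (cmod (e (real m * real l / real q) - 1) /
            (cmod (e (real m / real q) - 1) * cmod (e (real m * of_int p / real q) - 1)))\<^sup>2"
    if m: "m \<in> {1..<q}" for m
  proof -
    define w where "w = e (- (real m * of_int p / real q))"
    have nz: "e (real m / real q) \<noteq> 1"
      using m of_int_div_Ints_iff[of q "int m"] by (auto simp: e_eq_1_iff dest!: zdvd_imp_le)
    have "\<not> int q dvd - (int m * p)"
      using m assms by (auto simp: coprime_dvd_mult_left_iff coprime_commute dest!: zdvd_imp_le)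
    then have "w \<noteq> 1"
      using m of_int_div_Ints_iff[of q "- (int m * p)"] by (simp add: w_def e_eq_1_iff)
    have wn: "w ^ n = e (- (real m * (of_int (int n * p) / real q)))" for n
      unfolding w_def e_power by (simp add: mult_ac)
    have "(\<Sum>n=1..q. of_real (arc_visit q p A l n - real l / real q) * w ^ n)
        = (\<Sum>n=1..q. of_real (arc_visit q p A l n) * w ^ n) - of_real (real l / real q) * (\<Sum>n=1..q. w ^ n)"
      by (simp add: left_diff_distrib sum_subtractf sum_distrib_left)
    also have "(\<Sum>n=1..q. w ^ n) = 0"
      unfolding w_def by (rule sum_e_powers_eq_0[of _ _ "- (int m * p)"]) (use \<open>w \<noteq> 1\<close> assms in \<open>simp_all add: w_def\<close>)
    finally have s: "(\<Sum>n=1..q. of_real (arc_visit q p A l n - real l / real q) * w ^ n)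
        = (\<Sum>r=A..<A+l. e (- (real m * (real r / real q))))"
      by (simp only: wn sum_arc_visit[OF assms(1-3)]) simp
    have "(\<Sum>n=1..q. of_real (arc_visit q p A l n - real l / real q) * w ^ n)
        = (\<Sum>n=1..q. (complex_of_real (arc_discrepancy q p A l n) - of_real (arc_discrepancy q p A l (n - 1))) * w ^ n)"
    proof (intro sum.cong refl)
      fix n assume "n \<in> {1..q}"
      then obtain k where "n = Suc k" by (cases n) auto
      then show "of_real (arc_visit q p A l n - real l / real q) * w ^ n
        = (complex_of_real (arc_discrepancy q p A l n) - of_real (arc_discrepancy q p A l (n - 1))) * w ^ n"
        by (simp add: arc_discrepancy_Suc)
    qed
    also have "\<dots> = (1 - w) * (\<Sum>n=1..q. of_real (arc_discrepancy q p A l n) * w ^ n)"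
      by (subst summation_by_parts_cyclic) (simp_all add: arc_discrepancy_period[OF assms(1-3)])
    also have "(\<Sum>n=1..q. of_real (arc_discrepancy q p A l n) * w ^ n) = F (int m * p)"
      unfolding F_def wn by (simp add: mult_ac)
    finally have "cmod (1 - w) * cmod (F (int m * p)) = cmod (\<Sum>r=A..<A+l. e (- (real m * (real r / real q))))"
      using s by (simp only: norm_mult[symmetric])
    moreover have "cmod (1 - w) = cmod (e (real m * of_int p / real q) - 1)"
      unfolding w_def by (metis cnj_e complex_cnj_diff complex_cnj_one complex_mod_cnj norm_minus_commute)
    ultimately have "cmod (e (real m * real l / real q) - 1)
       = cmod (F (int m * p)) * (cmod (e (real m / real q) - 1) * cmod (e (real m * of_int p / real q) - 1))"
      using norm_sum_e_arc[OF assms(1), of m A l] by (metis mult.assoc mult.commute)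
    moreover have "cmod (e (real m * of_int p / real q) - 1) \<noteq> 0"
      using \<open>w \<noteq> 1\<close> \<open>cmod (1 - w) = _\<close> by auto
    ultimately show ?thesis using nz by simp
  qed
  have "bij_betw (\<lambda>n. int n * p mod int q) ({1..q} - {q}) ({0..<int q} - {0})"
    using bij_betw_DiffI[OF bij_betw_mult_mod[OF assms(1,2)], of "{q}" "{0}"] assms
    by (simp add: bij_betw_def)
  moreover have "{1..q} - {q} = {1..<q}" "{0..<int q} - {0} = int ` {1..<q}"
    by (auto simp: image_int_atLeastLessThan)
  ultimately have bij: "bij_betw (\<lambda>n. int n * p mod int q) {1..<q} (int ` {1..<q})" by simp
  have "(\<Sum>t=1..<q. (cmod (F (int t)))\<^sup>2) = (\<Sum>t\<in>int ` {1..<q}. (cmod (F t))\<^sup>2)"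
    by (subst sum.reindex) auto
  also have "\<dots> = (\<Sum>m=1..<q. (cmod (F (int m * p mod int q)))\<^sup>2)"
    by (rule sum.reindex_bij_betw[OF bij, symmetric])
  also have "\<dots> = (\<Sum>m=1..<q. (cmod (e (real m * real l / real q) - 1) /
            (cmod (e (real m / real q) - 1) * cmod (e (real m * of_int p / real q) - 1)))\<^sup>2)"
    by (intro sum.cong refl) (simp only: F_mod F_eq)
  finally show ?thesis
    using variance_cyclic[OF assms(1) \<mu>] by (simp add: F_def)
qed

section \<open>Replacing the rotation by a rational one\<close>

text \<open>The two points differ by at most \<open>1 / q\<close> modulo 1, and rounding moves the endpoints of the interval
  by less than \<open>2 / q\<close>. So the two indicators can disagree only when \<open>n \<alpha>\<close> is within \<open>3 / q\<close> of an
  endpoint modulo 1.\<close>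

lemma indicator_eq_arc_visit:
  assumes q: "q > 0" and close: "\<bar>real n * \<alpha> - real n * of_int p / real q\<bar> \<le> 1 / real q"
    and ab: "0 \<le> a" "a \<le> b" "b \<le> 1" and A: "A = nat \<lfloor>a * real q\<rfloor>" and l: "l = nat \<lfloor>(b - a) * real q\<rfloor>"
    and far: "dist_nearest_int (real n * \<alpha> - a) > 3 / real q" "dist_nearest_int (real n * \<alpha> - b) > 3 / real q"
  shows "indicator {a..b} (frac (real n * \<alpha>)) = arc_visit q p A l n"
proof -
  define r where "r = int n * p mod int q"
  define x where "x = frac (real n * \<alpha>)"
  define y where "y = real_of_int r / real q"
  define d where "d = 1 / real q"
  have d: "d > 0" "3 / real q = 3 * d" using q by (auto simp: d_def)
  have x: "0 \<le> x" "x < 1" by (auto simp: x_def frac_lt_1)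
  have "0 \<le> r" "r < int q" using q by (simp_all add: r_def)
  then have y: "0 \<le> y" "y < 1" using q by (auto simp: y_def)
  have "int n * p = int q * (int n * p div int q) + r" by (simp add: r_def)
  then have "real n * of_int p = real q * of_int (int n * p div int q) + of_int r"
    by (metis of_int_add of_int_mult of_int_of_nat_eq)
  then have "real n * of_int p / real q = of_int (int n * p div int q) + y"
    using q by (simp add: y_def field_simps)
  then obtain j :: int where j: "\<bar>x - y + of_int j\<bar> \<le> d"
    using close that[of "\<lfloor>real n * \<alpha>\<rfloor> - int n * p div int q"]
    by (simp add: x_def frac_def d_def algebra_simps)
  have far_a: "\<bar>x - a - of_int i\<bar> > 3 * d" for i
    using far(1) dist_nearest_int_le[of "real n * \<alpha> - a" "\<lfloor>real n * \<alpha>\<rfloor> + i"] d by (simp add: x_def frac_def algebra_simps)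
  have far_b: "\<bar>x - b - of_int i\<bar> > 3 * d" for i
    using far(2) dist_nearest_int_le[of "real n * \<alpha> - b" "\<lfloor>real n * \<alpha>\<rfloor> + i"] d by (simp add: x_def frac_def algebra_simps)
  have A': "real A \<le> a * real q" "a * real q < real A + 1"
    using ab by (auto simp: A of_nat_nat) 
  have l': "real l \<le> (b - a) * real q" "(b - a) * real q < real l + 1"
    using ab by (auto simp: l of_nat_nat)
  have lo: "real A / real q \<le> a" "a < real A / real q + d"
    using A' q by (auto simp: d_def field_simps)
  have hi: "real (A + l) / real q \<le> b" "b < real (A + l) / real q + 2 * d"
    using A' l' q by (auto simp: d_def field_simps)
  have iff: "r \<in> {int A..<int (A + l)} \<longleftrightarrow> real A / real q \<le> y \<and> y < real (A + l) / real q"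
    using q by (auto simp: y_def divide_le_cancel divide_less_cancel)
  have "x \<in> {a..b} \<longleftrightarrow> real A / real q \<le> y \<and> y < real (A + l) / real q"
  proof -
    (* j = 0 is the generic case; otherwise the integer 0 separates x from y on the circle. *)
    consider "j = 0" | "j \<ge> 1" | "j \<le> -1" by linarith
    then show ?thesis
    proof cases
      case 1
      then show ?thesis
        using j far_a[of 0] far_b[of 0] lo hi d by auto
    next
      case 2
      \<comment> \<open>\<open>x\<close> is just above 0 and \<open>y\<close> just below 1\<close>
      then have "real_of_int j \<ge> 1" by simp
      then show ?thesis
        using j far_a[of 0] far_b[of "-1"] lo hi d x y ab by auto
    next
      case 3
      \<comment> \<open>\<open>y\<close> is just above 0 and \<open>x\<close> just below 1\<close>
      then have "real_of_int j \<le> -1" by simp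
      then show ?thesis
        using j far_a[of 1] far_b[of 0] lo hi d x y ab by auto
    qed
  qed
  then show ?thesis
    unfolding arc_visit_def r_def[symmetric] iff x_def[symmetric] by (simp add: indicator_def)
qed

lemma card_separated_le:
  fixes X :: "nat set"
  assumes X: "X \<subseteq> {1..q}" and \<delta>: "\<delta> > 0"
    and sep: "\<And>m n. m \<in> X \<Longrightarrow> n \<in> X \<Longrightarrow> m \<noteq> n \<Longrightarrow> \<delta> \<le> \<bar>real m - real n\<bar>"
  shows "real (card X) \<le> real q / \<delta> + 1"
proof -
  (* Each cell of length \<delta> contains at most one point of X. *)
  define h where "h = (\<lambda>n. nat \<lfloor>real n / \<delta>\<rfloor>)"
  have "inj_on h X"
  proof (rule inj_onI, rule ccontr)
    fix m n assume mn: "m \<in> X" "n \<in> X" "h m = h n" "m \<noteq> n"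
    have "\<lfloor>real m / \<delta>\<rfloor> = \<lfloor>real n / \<delta>\<rfloor>"
      using mn(3) \<delta> by (simp add: h_def eq_nat_nat_iff)
    then have "\<bar>real m / \<delta> - real n / \<delta>\<bar> < 1" by linarith
    then have "\<bar>real m - real n\<bar> < \<delta>"
      using \<delta> by (simp add: abs_less_iff field_simps)
    with sep[OF mn(1,2,4)] show False by simp
  qed
  moreover have "h ` X \<subseteq> {..nat \<lfloor>real q / \<delta>\<rfloor>}"
    using X \<delta> by (auto simp: h_def intro!: nat_mono floor_mono divide_right_mono)
  ultimately have "card X \<le> card {..nat \<lfloor>real q / \<delta>\<rfloor>}"
    by (metis card_image card_mono finite_atMost)
  also have "\<dots> = nat \<lfloor>real q / \<delta>\<rfloor> + 1" by simp
  finally have "real (card X) \<le> real (nat \<lfloor>real q / \<delta>\<rfloor>) + 1" by linarith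
  moreover have "real (nat \<lfloor>real q / \<delta>\<rfloor>) \<le> real q / \<delta>"
    using \<delta> by (intro of_nat_floor) simp
  ultimately show ?thesis by linarith
qed

text \<open>If \<open>m \<alpha>\<close> and \<open>n \<alpha>\<close> are both close to \<open>s\<close>, then \<open>\<parallel>(m - n) \<alpha>\<parallel> \<le> 6 / q\<close>, and bad approximability
  forces \<open>|m - n| \<ge> c q / 6\<close>.\<close>

lemma card_near_point_le:
  assumes c: "c > 0" and bad: "\<And>n::int. n \<noteq> 0 \<Longrightarrow> c \<le> \<bar>of_int n\<bar> * dist_nearest_int (of_int n * \<alpha>)"
    and "q > 0"
  shows "real (card {n \<in> {1..q}. dist_nearest_int (real n * \<alpha> - s) \<le> 3 / real q}) \<le> 6 / c + 1"
proof -
  have "real (card {n \<in> {1..q}. dist_nearest_int (real n * \<alpha> - s) \<le> 3 / real q}) \<le> real q / (c * real q / 6) + 1"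
  proof (rule card_separated_le)
    fix m n assume m: "m \<in> {n \<in> {1..q}. dist_nearest_int (real n * \<alpha> - s) \<le> 3 / real q}"
      and n: "n \<in> {n \<in> {1..q}. dist_nearest_int (real n * \<alpha> - s) \<le> 3 / real q}" and "m \<noteq> n"
    have "dist_nearest_int (of_int (int m - int n) * \<alpha>) \<le> 6 / real q"
      using dist_nearest_int_triangle[of "real m * \<alpha> - s" "real n * \<alpha> - s"] m n by (simp add: left_diff_distrib)
    then have "\<bar>of_int (int m - int n)\<bar> * dist_nearest_int (of_int (int m - int n) * \<alpha>) \<le> \<bar>of_int (int m - int n)\<bar> * (6 / real q)"
      by (intro mult_left_mono) auto
    with bad[of "int m - int n"] \<open>m \<noteq> n\<close> have "c \<le> \<bar>real m - real n\<bar> * (6 / real q)" by simp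
    then show "c * real q / 6 \<le> \<bar>real m - real n\<bar>"
      using \<open>q > 0\<close> by (simp add: field_simps)
  qed (use assms in auto)
  then show ?thesis using \<open>q > 0\<close> by (simp add: field_simps)
qed

text \<open>Disagreements of the indicators account for \<open>2 (6 / c + 1)\<close>, and the difference between the lengths
  \<open>L\<close> and \<open>l / q\<close>, accumulated over at most \<open>q\<close> terms, for 1.\<close>

lemma birkhoff_sum_close:
  assumes c: "c > 0" and bad: "\<And>n::int. n \<noteq> 0 \<Longrightarrow> c \<le> \<bar>of_int n\<bar> * dist_nearest_int (of_int n * \<alpha>)"
    and q: "q > 0" and p: "\<bar>real q * \<alpha> - of_int p\<bar> \<le> 1 / real q"
    and ab: "0 \<le> a" "a \<le> b" "b \<le> 1" and A: "A = nat \<lfloor>a * real q\<rfloor>" and l: "l = nat \<lfloor>(b - a) * real q\<rfloor>"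
    and N: "N \<le> q"
  shows "\<bar>birkhoff_sum \<alpha> (interval_discrepancy_fun a b) N - arc_discrepancy q p A l N\<bar> \<le> 12 / c + 3"
proof -
  define X where "X = (\<lambda>s. {n \<in> {1..q}. dist_nearest_int (real n * \<alpha> - s) \<le> 3 / real q})"
  define \<phi> where "\<phi> = (\<lambda>n. indicator {a..b} (frac (real n * \<alpha>)) - arc_visit q p A l n)"
  define \<psi> where "\<psi> = (\<lambda>n. indicator (X a) n + indicator (X b) n :: real)"
  have \<phi>: "\<bar>\<phi> n\<bar> \<le> \<psi> n" if n: "n \<in> {1..q}" for n
  proof (cases "n \<in> X a \<or> n \<in> X b")
    case True
    then show ?thesis by (auto simp: \<phi>_def \<psi>_def arc_visit_def indicator_def)
  next
    case False
    have "\<bar>real n * \<alpha> - real n * of_int p / real q\<bar> \<le> real n / (real q)\<^sup>2"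
      by (rule mult_rational_approx[OF q p])
    also have "\<dots> \<le> real q / (real q)\<^sup>2"
      using n by (intro divide_right_mono) auto
    also have "\<dots> = 1 / real q"
      by (simp add: power2_eq_square)
    finally show ?thesis
      using indicator_eq_arc_visit[OF q _ ab A l, of n \<alpha> p] False n
      by (simp add: X_def \<phi>_def \<psi>_def)
  qed
  have "\<bar>\<Sum>n=1..N. \<phi> n\<bar> \<le> (\<Sum>n=1..N. \<psi> n)"
    by (rule order.trans[OF sum_abs sum_mono]) (use N \<phi> in auto)
  also have "\<dots> \<le> (\<Sum>n=1..q. \<psi> n)"
    using N by (intro sum_mono2) (auto simp: \<psi>_def)
  also have "\<dots> = real (card (X a)) + real (card (X b))"
  proof -
    have "(\<Sum>n=1..q. indicator (X s) n :: real) = (\<Sum>n\<in>X s. 1)" for s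
      by (rule sum.mono_neutral_cong_right) (auto simp: X_def)
    then show ?thesis by (simp add: \<psi>_def sum.distrib)
  qed
  also have "\<dots> \<le> (6 / c + 1) + (6 / c + 1)"
    unfolding X_def by (intro add_mono card_near_point_le[OF c bad q])
  finally have 1: "\<bar>\<Sum>n=1..N. \<phi> n\<bar> \<le> 12 / c + 2" by simp
  have l': "real l \<le> (b - a) * real q" "(b - a) * real q < real l + 1"
    using ab by (auto simp: l of_nat_nat)
  have "\<bar>real l / real q - (b - a)\<bar> \<le> 1 / real q"
  proof -
    have "real l / real q - (b - a) = (real l - (b - a) * real q) / real q"
      using q by (simp add: field_simps)
    moreover have "\<bar>real l - (b - a) * real q\<bar> \<le> 1" using l' by linarith
    ultimately show ?thesis using q by (simp add: abs_divide divide_right_mono)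
  qed
  then have "real N * \<bar>real l / real q - (b - a)\<bar> \<le> real q * (1 / real q)"
    using N by (intro mult_mono) auto
  then have 2: "\<bar>real N * (real l / real q - (b - a))\<bar> \<le> 1"
    using q by (simp add: abs_mult)
  have "birkhoff_sum \<alpha> (interval_discrepancy_fun a b) N - arc_discrepancy q p A l N
     = (\<Sum>n=1..N. \<phi> n) + real N * (real l / real q - (b - a))"
    by (simp add: birkhoff_sum_def interval_discrepancy_fun_def arc_discrepancy_def \<phi>_def sum_subtractf right_diff_distrib)
  with 1 2 show ?thesis by linarith
qed

section \<open>Upper bound for the rational variance\<close>

text \<open>Compare with the telescoping sum of \<open>1 / (k - 1) - 1 / k\<close>.\<close>

lemma sum_inverse_squares_le: "(\<Sum>k=1..n. 1 / (real k)\<^sup>2) \<le> 2"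
proof -
  have "(\<Sum>k=1..Suc n. 1 / (real k)\<^sup>2) \<le> 2 - 1 / real (Suc n)" for n
  proof (induction n)
    case (Suc n)
    have "1 / (x + 1)\<^sup>2 \<le> 1 / x - 1 / (x + 1)" if "x > 0" for x :: real
    proof -
      have "1 / x - 1 / (x + 1) = 1 / (x * (x + 1))"
        using that by (simp add: field_simps)
      moreover have "1 / (x + 1)\<^sup>2 \<le> 1 / (x * (x + 1))"
        using that by (intro divide_left_mono) (auto simp: power2_eq_square)
      ultimately show ?thesis by simp
    qed
    from this[of "real (Suc n)"] Suc show ?case by (simp add: add_ac)
  qed simp
  from this[of "n - 1"] show ?thesis
    by (cases n) (auto intro: order.trans)
qed

lemma dist_nearest_int_cases: "dist_nearest_int x = frac x \<or> dist_nearest_int x = frac (- x)"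
proof (cases "frac x \<ge> 1 / 2")
  case True
  then have "x \<notin> \<int>" using frac_eq_0_iff[of x] by linarith
  then have "frac (- x) = of_int \<lceil>x\<rceil> - x"
    by (simp add: frac_def ceiling_def)
  moreover have "of_int \<lceil>x\<rceil> \<ge> x" by simp
  ultimately show ?thesis using True by (simp add: dist_nearest_int_def round_altdef)
next
  case False
  then show ?thesis by (simp add: dist_nearest_int_def round_altdef frac_def)
qed

lemma dist_nearest_int_le_frac: "dist_nearest_int x \<le> frac x"
  using dist_nearest_int_le[of x "\<lfloor>x\<rfloor>"] by (simp add: frac_def)

text \<open>The separation puts the fractional parts into distinct cells \<open>[k / K, (k + 1) / K)\<close> with
  \<open>K = Y / c\<close> and \<open>k \<ge> 1\<close>, so the sum is dominated by \<open>K\<^sup>2 \<Sum> 1 / k\<^sup>2\<close>. Fractional parts are used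
  instead of distances to the nearest integer because these would put two points, one on each side
  of 0, into the same cell.\<close>

lemma sum_inverse_frac_squares_le:
  assumes c: "c > 0" and sep: "\<And>m. m \<in> {1..Y} \<Longrightarrow> c / real Y \<le> dist_nearest_int (real m * \<beta>)"
  shows "(\<Sum>m=1..Y. 1 / (frac (real m * \<beta>))\<^sup>2) \<le> 2 * (real Y / c)\<^sup>2"
proof (cases "Y = 0")
  case False
  define K where "K = real Y / c"
  have K: "K > 0" "c / real Y = 1 / K" using c False by (auto simp: K_def)
  define k where "k = (\<lambda>m. nat \<lfloor>frac (real m * \<beta>) * K\<rfloor>)"
  have fl: "0 \<le> \<lfloor>frac (real m * \<beta>) * K\<rfloor>" for m
    using K by simp
  have fK: "frac (real m * \<beta>) * K \<ge> 1" if "m \<in> {1..Y}" for m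
  proof -
    have "1 / K \<le> frac (real m * \<beta>)"
      using sep[OF that] dist_nearest_int_le_frac[of "real m * \<beta>"] K by linarith
    then show ?thesis using K by (simp add: field_simps)
  qed
  have "1 \<le> \<lfloor>frac (real m * \<beta>) * K\<rfloor>" if "m \<in> {1..Y}" for m
    using fK[OF that] by (simp add: le_floor_iff)
  then have k1: "k m \<ge> 1" if "m \<in> {1..Y}" for m
    unfolding k_def by (subst le_nat_iff) (use that fl in auto)
  have inj: "inj_on k {1..Y}"
  proof (rule linorder_inj_onI)
    fix m n assume mn: "m < n" "m \<in> {1..Y}" "n \<in> {1..Y}"
    show "k m \<noteq> k n"
    proof
      assume "k m = k n"
      then have "\<lfloor>frac (real m * \<beta>) * K\<rfloor> = \<lfloor>frac (real n * \<beta>) * K\<rfloor>"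
        using fl by (simp add: k_def eq_nat_nat_iff)
      then have "\<bar>frac (real n * \<beta>) * K - frac (real m * \<beta>) * K\<bar> < 1" by linarith
      then have "\<bar>frac (real n * \<beta>) - frac (real m * \<beta>)\<bar> * K < 1"
        using K by (simp add: abs_mult flip: left_diff_distrib)
      then have "\<bar>frac (real n * \<beta>) - frac (real m * \<beta>)\<bar> < 1 / K"
        using K by (simp add: field_simps)
      moreover have "dist_nearest_int (real (n - m) * \<beta>) \<le> \<bar>frac (real n * \<beta>) - frac (real m * \<beta>)\<bar>"
        using dist_nearest_int_le[of "real (n - m) * \<beta>" "\<lfloor>real n * \<beta>\<rfloor> - \<lfloor>real m * \<beta>\<rfloor>"] mn
        by (simp add: frac_def of_nat_diff algebra_simps)
      moreover have "1 / K \<le> dist_nearest_int (real (n - m) * \<beta>)"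
      proof -
        have "n - m \<in> {1..Y}" using mn by auto
        from sep[OF this] show ?thesis unfolding K(2) .
      qed
      ultimately show False by linarith
    qed
  qed (simp add: linear)
  have term_le: "1 / (frac (real m * \<beta>))\<^sup>2 \<le> K\<^sup>2 * (1 / (real (k m))\<^sup>2)" if m: "m \<in> {1..Y}" for m
  proof -
    have "real (k m) \<le> frac (real m * \<beta>) * K"
      unfolding k_def using K by (intro of_nat_floor) simp
    then have "(real (k m))\<^sup>2 \<le> (frac (real m * \<beta>))\<^sup>2 * K\<^sup>2"
      by (metis of_nat_0_le_iff power_mono power_mult_distrib)
    moreover have "(frac (real m * \<beta>))\<^sup>2 > 0" "(real (k m))\<^sup>2 > 0"
    proof -
      have "frac (real m * \<beta>) \<noteq> 0"
      proof
        assume "frac (real m * \<beta>) = 0"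
        with fK[OF m] show False by (simp only: mult_zero_left)
      qed
      then show "(frac (real m * \<beta>))\<^sup>2 > 0" by (simp only: zero_less_power2 not_False_eq_True)
      show "(real (k m))\<^sup>2 > 0" using k1[OF m] by simp
    qed
    ultimately show ?thesis by (simp add: field_simps)
  qed
  have "k m \<le> nat \<lfloor>K\<rfloor>" for m
    unfolding k_def using K by (intro nat_mono floor_mono) (simp add: frac_lt_1 less_imp_le mult_left_le_one_le)
  then have sub: "k ` {1..Y} \<subseteq> {1..nat \<lfloor>K\<rfloor>}"
    using k1 by auto
  have "(\<Sum>m=1..Y. 1 / (frac (real m * \<beta>))\<^sup>2) \<le> (\<Sum>m=1..Y. K\<^sup>2 * (1 / (real (k m))\<^sup>2))"
    by (intro sum_mono term_le)
  also have "\<dots> = K\<^sup>2 * (\<Sum>j\<in>k ` {1..Y}. 1 / (real j)\<^sup>2)"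
    using inj by (simp add: sum.reindex sum_distrib_left)
  also have "\<dots> \<le> K\<^sup>2 * (\<Sum>j=1..nat \<lfloor>K\<rfloor>. 1 / (real j)\<^sup>2)"
    using sub by (intro mult_left_mono sum_mono2) auto
  also have "\<dots> \<le> K\<^sup>2 * 2"
    by (intro mult_left_mono sum_inverse_squares_le) auto
  finally show ?thesis by (simp add: K_def mult.commute)
qed simp

lemma inverse_dist_square_le:
  "1 / (dist_nearest_int x)\<^sup>2 \<le> 1 / (frac x)\<^sup>2 + 1 / (frac (- x))\<^sup>2"
  using dist_nearest_int_cases[of x] by auto

lemma sum_inverse_dist_squares_le:
  assumes c: "c > 0" and sep: "\<And>m. m \<in> {1..Y} \<Longrightarrow> c / real Y \<le> dist_nearest_int (real m * \<beta>)"
  shows "(\<Sum>m=1..Y. 1 / (dist_nearest_int (real m * \<beta>))\<^sup>2) \<le> 4 * (real Y / c)\<^sup>2"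
proof -
  have sep': "c / real Y \<le> dist_nearest_int (real m * (- \<beta>))" if "m \<in> {1..Y}" for m
    using sep[OF that] by simp
  have "(\<Sum>m=1..Y. 1 / (dist_nearest_int (real m * \<beta>))\<^sup>2)
     \<le> (\<Sum>m=1..Y. 1 / (frac (real m * \<beta>))\<^sup>2 + 1 / (frac (real m * (- \<beta>)))\<^sup>2)"
    using inverse_dist_square_le by (intro sum_mono) simp
  also have "\<dots> \<le> 2 * (real Y / c)\<^sup>2 + 2 * (real Y / c)\<^sup>2"
    unfolding sum.distrib
    by (intro add_mono sum_inverse_frac_squares_le[OF c] sep sep')
  finally show ?thesis by simp
qed

text \<open>Partial summation: quadratic growth of the partial sums of \<open>w\<close> makes each step of the summation
  cost at most \<open>2 K / (x + 1)\<close>, a harmonic sum.\<close>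

lemma sum_div_squares_le_ln:
  fixes w :: "nat \<Rightarrow> real"
  assumes "n \<ge> 1" and K: "K \<ge> 0"
    and W: "\<And>Y. Y \<in> {1..n} \<Longrightarrow> (\<Sum>m=1..Y. w m) \<le> K * (real Y)\<^sup>2"
  shows "(\<Sum>m=1..n. w m / (real m)\<^sup>2) \<le> K * (1 + 2 * ln (real n))"
proof -
  have "(\<Sum>m=1..j. w m / (real m)\<^sup>2) \<le> (\<Sum>m=1..j. w m) / (real j)\<^sup>2 + 2 * K * ln (real j)"
    if "1 \<le> j" "j \<le> n" for j
    using that
  proof (induction j rule: nat_induct_at_least)
    case base
    then show ?case by simp
  next
    case (Suc j)
    define S where "S = (\<Sum>m=1..j. w m)"
    define x where "x = real j"
    have x: "x \<ge> 1" "real (Suc j) = x + 1" using Suc by (auto simp: x_def)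
    have S: "S \<le> K * x\<^sup>2"
      using W[of j] Suc by (simp add: S_def x_def)
    have "1 / x\<^sup>2 - 1 / (x + 1)\<^sup>2 \<ge> 0"
      using x by (simp add: frac_le)
    then have "S * (1 / x\<^sup>2 - 1 / (x + 1)\<^sup>2) \<le> K * x\<^sup>2 * (1 / x\<^sup>2 - 1 / (x + 1)\<^sup>2)"
      by (rule mult_right_mono[OF S])
    also have "\<dots> = K * (1 - x\<^sup>2 / (x + 1)\<^sup>2)"
      using x by (simp add: right_diff_distrib)
    also have "1 - x\<^sup>2 / (x + 1)\<^sup>2 = ((x + 1)\<^sup>2 - x\<^sup>2) / (x + 1)\<^sup>2"
      using x by (simp add: diff_divide_distrib)
    also have "(x + 1)\<^sup>2 - x\<^sup>2 = 2 * x + 1"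
      by (simp add: power2_eq_square algebra_simps)
    finally have le2: "S * (1 / x\<^sup>2 - 1 / (x + 1)\<^sup>2) \<le> K * ((2 * x + 1) / (x + 1)\<^sup>2)" .
    have "(2 * x + 1) / (x + 1)\<^sup>2 \<le> 2 * (x + 1) / (x + 1)\<^sup>2"
      using x by (intro divide_right_mono) auto
    also have "\<dots> = 2 * (1 / (x + 1))"
    proof -
      have "x + 1 \<noteq> 0" using x by simp
      then show ?thesis by (simp only: power2_eq_square times_divide_eq_right mult_1_right) (rule nonzero_mult_divide_mult_cancel_right)
    qed
    finally have le1: "(2 * x + 1) / (x + 1)\<^sup>2 \<le> 2 * (1 / (x + 1))" .
    have 1: "S / x\<^sup>2 - S / (x + 1)\<^sup>2 \<le> 2 * K * (1 / (x + 1))"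
    proof -
      have "S / x\<^sup>2 - S / (x + 1)\<^sup>2 = S * (1 / x\<^sup>2 - 1 / (x + 1)\<^sup>2)"
        by (simp add: right_diff_distrib)
      also note le2
      also have "K * ((2 * x + 1) / (x + 1)\<^sup>2) \<le> K * (2 * (1 / (x + 1)))"
        using le1 K by (rule mult_left_mono)
      also have "K * (2 * (1 / (x + 1))) = 2 * K * (1 / (x + 1))" by simp
      finally show ?thesis .
    qed
    have "ln (x / (x + 1)) \<le> x / (x + 1) - 1"
      using x by (intro ln_le_minus_one) auto
    also have "\<dots> = - (1 / (x + 1))" using x by (simp add: field_simps)
    finally have "1 / (x + 1) \<le> ln (x + 1) - ln x"
      using x by (simp add: ln_div)
    then have "2 * K * (1 / (x + 1)) \<le> 2 * K * (ln (x + 1) - ln x)"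
      using K by (intro mult_left_mono) auto
    then have "S / x\<^sup>2 + 2 * K * ln x \<le> S / (x + 1)\<^sup>2 + 2 * K * ln (x + 1)"
      using 1 by (simp add: right_diff_distrib)
    moreover have "(\<Sum>m=1..j. w m / (real m)\<^sup>2) \<le> S / x\<^sup>2 + 2 * K * ln x"
      using Suc by (simp add: S_def x_def)
    moreover have "(\<Sum>m=1..Suc j. w m / (real m)\<^sup>2) = (\<Sum>m=1..j. w m / (real m)\<^sup>2) + w (Suc j) / (x + 1)\<^sup>2"
      using x(2) by simp
    moreover have "(\<Sum>m=1..Suc j. w m) / (real (Suc j))\<^sup>2 = S / (x + 1)\<^sup>2 + w (Suc j) / (x + 1)\<^sup>2"
      unfolding x(2) by (simp add: S_def add_divide_distrib)
    ultimately show ?case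
      unfolding x(2) by linarith
  qed
  from this[of n] have "(\<Sum>m=1..n. w m / (real m)\<^sup>2) \<le> (\<Sum>m=1..n. w m) / (real n)\<^sup>2 + 2 * K * ln (real n)"
    using assms by simp
  also have "(\<Sum>m=1..n. w m) / (real n)\<^sup>2 \<le> K"
    using W[of n] assms by (simp add: field_simps)
  finally show ?thesis by (simp add: algebra_simps)
qed

lemma dist_nearest_int_rational_ge:
  assumes "q > 0" "\<not> int q dvd k"
  shows "1 / real q \<le> dist_nearest_int (of_int k / real q)"
proof -
  define j where "j = round (of_int k / real q)"
  have "k - j * int q \<noteq> 0" using assms(2) by auto
  then have "1 \<le> \<bar>real_of_int (k - j * int q)\<bar>" by linarith
  moreover have "of_int k / real q - of_int j = real_of_int (k - j * int q) / real q"
    using assms(1) by (simp add: field_simps)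
  ultimately show ?thesis
    using assms(1) by (simp add: dist_nearest_int_def j_def[symmetric] abs_divide divide_right_mono)
qed

text \<open>Up to a factor 2 in the constant, \<open>p / q\<close> is as badly approximable as \<open>\<alpha>\<close> by denominators
  below \<open>q\<close>: for small \<open>m\<close> the
  bound is inherited from \<open>\<alpha>\<close>, with loss \<open>m / q\<^sup>2\<close>, and for \<open>m\<close> comparable with \<open>q\<close> it is the trivial
  bound \<open>1 / q\<close> for a nonintegral multiple of \<open>1 / q\<close>.\<close>

lemma dist_nearest_int_convergent_ge:
  assumes c: "0 < c" "c \<le> 1 / 2" and bad: "\<And>n::int. n \<noteq> 0 \<Longrightarrow> c \<le> \<bar>of_int n\<bar> * dist_nearest_int (of_int n * \<alpha>)"
    and q: "q > 0" "coprime p (int q)" and p: "\<bar>real q * \<alpha> - of_int p\<bar> \<le> 1 / real q"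
    and m: "m \<in> {1..<q}"
  shows "c / 2 / real m \<le> dist_nearest_int (real m * of_int p / real q)"
proof (cases "(real m)\<^sup>2 \<le> c / 2 * (real q)\<^sup>2")
  case True
  have "c / real m \<le> dist_nearest_int (real m * \<alpha>)"
    using bad[of "int m"] m by (simp add: field_simps)
  also have "\<dots> \<le> dist_nearest_int (real m * of_int p / real q) + real m / (real q)\<^sup>2"
    using dist_nearest_int_lipschitz[of "real m * \<alpha>" "real m * of_int p / real q"]
      mult_rational_approx[OF q(1) p, of m] by linarith
  also have "real m / (real q)\<^sup>2 \<le> c / 2 / real m"
    using True m q by (simp add: field_simps power2_eq_square)
  finally show ?thesis by (simp add: field_simps)
next
  case False
  have "(c / 2 * real q)\<^sup>2 \<le> c / 2 * (real q)\<^sup>2"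
  proof -
    have "(c / 2)\<^sup>2 \<le> c / 2"
      using c mult_left_mono[of "c / 2" 1 "c / 2"] by (simp add: power2_eq_square)
    then show ?thesis
      unfolding power_mult_distrib by (rule mult_right_mono) simp
  qed
  with False have "(c / 2 * real q)\<^sup>2 \<le> (real m)\<^sup>2" by linarith
  then have "c / 2 * real q \<le> real m"
    by (rule power2_le_imp_le) simp
  then have "c / 2 / real m \<le> 1 / real q"
    using m q by (simp add: field_simps)
  also have "\<not> int q dvd int m * p"
    using m q by (auto simp: coprime_dvd_mult_left_iff coprime_commute dest!: zdvd_imp_le)
  then have "1 / real q \<le> dist_nearest_int (real m * of_int p / real q)"
    using dist_nearest_int_rational_ge[OF q(1), of "int m * p"] by simp
  finally show ?thesis .
qed

text \<open>The symmetry \<open>m \<mapsto> q - m\<close> folds the range, so that \<open>\<parallel>m / q\<parallel>\<close> may be replaced by \<open>m / q\<close>.\<close>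

lemma sum_inverse_dist_products_le:
  assumes c: "0 < c" "c \<le> 1 / 2" and bad: "\<And>n::int. n \<noteq> 0 \<Longrightarrow> c \<le> \<bar>of_int n\<bar> * dist_nearest_int (of_int n * \<alpha>)"
    and q: "q > 0" "coprime p (int q)" and p: "\<bar>real q * \<alpha> - of_int p\<bar> \<le> 1 / real q"
  shows "(\<Sum>m=1..<q. 1 / ((dist_nearest_int (real m / real q))\<^sup>2 * (dist_nearest_int (real m * of_int p / real q))\<^sup>2))
      \<le> 32 / c\<^sup>2 * (real q)\<^sup>2 * (1 + 2 * ln (real q))"
proof (cases "q = 1")
  case False
  with q have q2: "q \<ge> 2" by linarith
  define \<beta> where "\<beta> = of_int p / real q"
  define w where "w = (\<lambda>m. 1 / (dist_nearest_int (real m * \<beta>))\<^sup>2)"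
  have "(\<Sum>m=1..q - 1. w m / (real m)\<^sup>2) \<le> 16 / c\<^sup>2 * (1 + 2 * ln (real (q - 1)))"
  proof (rule sum_div_squares_le_ln)
    fix Y assume Y: "Y \<in> {1..q - 1}"
    have "c / 2 / real Y \<le> dist_nearest_int (real m * \<beta>)" if m: "m \<in> {1..Y}" for m
    proof -
      have mq: "m \<in> {1..<q}" using m Y by auto
      have "c / 2 / real Y \<le> c / 2 / real m"
        using m c by (intro divide_left_mono) auto
      also have "\<dots> \<le> dist_nearest_int (real m * \<beta>)"
        using dist_nearest_int_convergent_ge[OF c bad q p mq] by (simp add: \<beta>_def)
      finally show ?thesis .
    qed
    then have "(\<Sum>m=1..Y. w m) \<le> 4 * (real Y / (c / 2))\<^sup>2"
      unfolding w_def using c by (intro sum_inverse_dist_squares_le) auto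
    then show "(\<Sum>m=1..Y. w m) \<le> 16 / c\<^sup>2 * (real Y)\<^sup>2"
      by (simp add: power_divide power_mult_distrib)
  qed (use q2 c in auto)
  also have "\<dots> \<le> 16 / c\<^sup>2 * (1 + 2 * ln (real q))"
    using q2 by (intro mult_left_mono add_left_mono) auto
  finally have le: "(\<Sum>m=1..q - 1. w m / (real m)\<^sup>2) \<le> 16 / c\<^sup>2 * (1 + 2 * ln (real q))" .
  have *: "(\<Sum>m=1..<q. w m / (real m)\<^sup>2) \<le> 16 / c\<^sup>2 * (1 + 2 * ln (real q))"
  proof -
    have "{1..q - 1} = {1..<q}" using q2 by auto
    with le show ?thesis by simp
  qed
  have w_sym: "w (q - m) = w m" if "m \<in> {1..<q}" for m
  proof -
    have "real (q - m) * \<beta> = - (real m * \<beta>) + of_int p"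
      using that by (simp add: \<beta>_def of_nat_diff field_simps)
    then have "dist_nearest_int (real (q - m) * \<beta>) = dist_nearest_int (real m * \<beta>)"
      by (simp only: dist_nearest_int_add_int dist_nearest_int_minus)
    then show ?thesis by (simp only: w_def)
  qed
  have "(\<Sum>m=1..<q. 1 / ((dist_nearest_int (real m / real q))\<^sup>2 * (dist_nearest_int (real m * of_int p / real q))\<^sup>2))
     \<le> (\<Sum>m=1..<q. (real q)\<^sup>2 * (w m / (real m)\<^sup>2) + (real q)\<^sup>2 * (w m / (real (q - m))\<^sup>2))"
  proof (rule sum_mono)
    fix m assume m: "m \<in> {1..<q}"
    have f: "frac (real m / real q) = real m / real q"
      using m by (simp add: frac_eq)
    have "frac (- (real m / real q)) = 1 - real m / real q"
    proof -
      have "\<not> q dvd m" using m by (auto dest: dvd_imp_le)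
      then have "real m / real q \<notin> \<int>"
        using of_int_div_Ints_iff[of q "int m"] q by simp
      then show ?thesis using f by (simp only: frac_neg if_False)
    qed
    then have f': "frac (- (real m / real q)) = real (q - m) / real q"
      using m by (simp add: of_nat_diff field_simps)
    have "1 / (dist_nearest_int (real m / real q))\<^sup>2 \<le> (real q)\<^sup>2 / (real m)\<^sup>2 + (real q)\<^sup>2 / (real (q - m))\<^sup>2"
      using inverse_dist_square_le[of "real m / real q"] unfolding f f' by (simp add: power_divide)
    then have "1 / (dist_nearest_int (real m / real q))\<^sup>2 * w m \<le> ((real q)\<^sup>2 / (real m)\<^sup>2 + (real q)\<^sup>2 / (real (q - m))\<^sup>2) * w m"
      by (rule mult_right_mono) (simp add: w_def)
    also have "\<dots> = (real q)\<^sup>2 * (w m / (real m)\<^sup>2) + (real q)\<^sup>2 * (w m / (real (q - m))\<^sup>2)"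
      by (simp add: distrib_right)
    finally show "1 / ((dist_nearest_int (real m / real q))\<^sup>2 * (dist_nearest_int (real m * of_int p / real q))\<^sup>2)
      \<le> (real q)\<^sup>2 * (w m / (real m)\<^sup>2) + (real q)\<^sup>2 * (w m / (real (q - m))\<^sup>2)"
      by (simp add: w_def \<beta>_def)
  qed
  also have "\<dots> = (real q)\<^sup>2 * (\<Sum>m=1..<q. w m / (real m)\<^sup>2) + (real q)\<^sup>2 * (\<Sum>m=1..<q. w m / (real (q - m))\<^sup>2)"
    by (simp add: sum.distrib sum_distrib_left)
  also have "(\<Sum>m=1..<q. w m / (real (q - m))\<^sup>2) = (\<Sum>m=1..<q. w m / (real m)\<^sup>2)"
    by (rule sum.reindex_bij_witness[where i="\<lambda>m. q - m" and j="\<lambda>m. q - m"]) (auto simp: w_sym)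
  also have "(real q)\<^sup>2 * (\<Sum>m=1..<q. w m / (real m)\<^sup>2) + (real q)\<^sup>2 * (\<Sum>m=1..<q. w m / (real m)\<^sup>2)
    \<le> (real q)\<^sup>2 * (16 / c\<^sup>2 * (1 + 2 * ln (real q))) + (real q)\<^sup>2 * (16 / c\<^sup>2 * (1 + 2 * ln (real q)))"
    by (intro add_mono mult_left_mono *) auto
  also have "\<dots> = 32 / c\<^sup>2 * (real q)\<^sup>2 * (1 + 2 * ln (real q))"
  proof -
    have "x * (16 / c\<^sup>2 * y) + x * (16 / c\<^sup>2 * y) = 32 / c\<^sup>2 * x * y" for x y :: real
      by (simp add: divide_inverse algebra_simps)
    then show ?thesis .
  qed
  finally show ?thesis .
qed simp

lemma arc_discrepancy_variance_le:
  assumes c: "0 < c" "c \<le> 1 / 2" and bad: "\<And>n::int. n \<noteq> 0 \<Longrightarrow> c \<le> \<bar>of_int n\<bar> * dist_nearest_int (of_int n * \<alpha>)"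
    and q: "q > 0" "coprime p (int q)" and p: "\<bar>real q * \<alpha> - of_int p\<bar> \<le> 1 / real q"
    and Al: "A + l \<le> q" and \<mu>: "\<mu> = (\<Sum>N=1..q. arc_discrepancy q p A l N) / real q"
  shows "(\<Sum>N=1..q. (arc_discrepancy q p A l N - \<mu>)\<^sup>2) \<le> 8 / c\<^sup>2 * real q * (1 + 2 * ln (real q))"
proof -
  have "(\<Sum>m=1..<q. (cmod (e (real m * real l / real q) - 1) /
            (cmod (e (real m / real q) - 1) * cmod (e (real m * of_int p / real q) - 1)))\<^sup>2)
    \<le> (\<Sum>m=1..<q. 1 / 4 * (1 / ((dist_nearest_int (real m / real q))\<^sup>2 * (dist_nearest_int (real m * of_int p / real q))\<^sup>2)))"
  proof (rule sum_mono)
    fix m assume m: "m \<in> {1..<q}"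
    let ?u = "dist_nearest_int (real m / real q)" and ?v = "dist_nearest_int (real m * of_int p / real q)"
    have u: "?u > 0"
    proof -
      have "\<not> q dvd m" using m by (auto dest: dvd_imp_le)
      then have "1 / real q \<le> ?u"
        using dist_nearest_int_rational_ge[OF q(1), of "int m"] by simp
      moreover have "1 / real q > 0" using q by simp
      ultimately show ?thesis by linarith
    qed
    have "0 < c / 2 / real m" using c m by simp
    also have "\<dots> \<le> ?v" by (rule dist_nearest_int_convergent_ge[OF c bad q p m])
    finally have v: "?v > 0" .
    have "cmod (e (real m * real l / real q) - 1) \<le> 2"
      using norm_triangle_ineq4[of "e (real m * real l / real q)" 1] by simp
    then have "cmod (e (real m * real l / real q) - 1) / (cmod (e (real m / real q) - 1) * cmod (e (real m * of_int p / real q) - 1))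
      \<le> 2 / ((2 * ?u) * (2 * ?v))"
      using u v by (intro frac_le mult_mono dist_nearest_int_chord) auto
    then have "(cmod (e (real m * real l / real q) - 1) / (cmod (e (real m / real q) - 1) * cmod (e (real m * of_int p / real q) - 1)))\<^sup>2
      \<le> (2 / ((2 * ?u) * (2 * ?v)))\<^sup>2"
      by (intro power_mono) auto
    also have "\<dots> = 1 / 4 * (1 / (?u\<^sup>2 * ?v\<^sup>2))"
      by (simp add: power_divide power_mult_distrib)
    finally show "(cmod (e (real m * real l / real q) - 1) / (cmod (e (real m / real q) - 1) * cmod (e (real m * of_int p / real q) - 1)))\<^sup>2
      \<le> 1 / 4 * (1 / (?u\<^sup>2 * ?v\<^sup>2))" .
  qed
  also have "\<dots> \<le> 1 / 4 * (32 / c\<^sup>2 * (real q)\<^sup>2 * (1 + 2 * ln (real q)))"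
    unfolding sum_distrib_left[symmetric]
    by (intro mult_left_mono sum_inverse_dist_products_le[OF c bad q p]) auto
  finally have "(\<Sum>N=1..q. (arc_discrepancy q p A l N - \<mu>)\<^sup>2) \<le> 8 / c\<^sup>2 * (real q)\<^sup>2 * (1 + 2 * ln (real q)) / real q"
    unfolding arc_discrepancy_variance[OF q Al \<mu>] by (intro divide_right_mono) auto
  then show ?thesis using q by (simp add: power2_eq_square)
qed

section \<open>Resonant multiples and the lower bound for the rational variance\<close>

text \<open>In place of the next continued fraction convergent any vector completing \<open>(p, q)\<close> to a
  unimodular pair will do; Bezout provides one with \<open>q'\<close> of the same size as \<open>q\<close>.\<close>

lemma unimodular_complement:
  fixes p :: int
  assumes "q > 0" "coprime p (int q)"
  obtains q' :: nat and p' :: int where "q \<le> q'" "q' < 2 * q" "int q' * p - p' * int q = 1"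
proof -
  obtain u v where uv: "u * p + v * int q = 1"
    using bezout_int[of p "int q"] assms(2) by auto
  define r where "r = u mod int q"
  define p' where "p' = p - (u div int q) * p - v"
  have r: "0 \<le> r" "r < int q" using assms by (simp_all add: r_def)
  have "r = u - int q * (u div int q)"
    by (simp add: r_def minus_mult_div_eq_mod)
  then have "(r + int q) * p - p' * int q = (u - int q * (u div int q) + int q) * p - p' * int q"
    by (simp only:)
  also have "\<dots> = u * p + v * int q"
    by (simp add: p'_def algebra_simps)
  finally have "int (nat (r + int q)) * p - p' * int q = 1"
    using r uv by simp
  moreover have "q \<le> nat (r + int q)" "nat (r + int q) < 2 * q" using r by auto
  ultimately show ?thesis using that by blast
qed

text \<open>The candidates are the Dirichlet denominator \<open>q\<close> and its unimodular complement \<open>q'\<close>. Suppose that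
  \<open>q L\<close> and \<open>q' L\<close> are within \<open>\<epsilon>\<close> of integers \<open>s\<close> and \<open>s'\<close>. Solving \<open>n p + l q = s\<close>, \<open>n p' + l q' = s'\<close>
  in integers gives \<open>|n| \<le> 3 \<epsilon> q\<close> and \<open>|L - n \<alpha> - l| \<le> 4 \<epsilon> / q\<close>, whence
  \<open>|n| \<parallel>n \<alpha> - L\<parallel> \<le> 12 \<epsilon>\<^sup>2\<close>. For \<open>n \<noteq> 0\<close> this contradicts the inhomogeneous condition, and for \<open>n = 0\<close>
  it puts \<open>L\<close> too close to an integer.\<close>

lemma exists_resonant_multiple:
  fixes L :: real
  assumes bad: "\<And>n::int. n \<noteq> 0 \<Longrightarrow> c \<le> \<bar>of_int n\<bar> * dist_nearest_int (of_int n * \<alpha>)"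
    and inhom: "\<And>n::int. n \<noteq> 0 \<Longrightarrow> c' \<le> \<bar>of_int n\<bar> * dist_nearest_int (of_int n * \<alpha> - L)"
    and \<epsilon>: "0 < \<epsilon>" "12 * \<epsilon>\<^sup>2 < c'" "4 * \<epsilon> < L" "4 * \<epsilon> < 1 - L"
    and Q: "Q > 0"
  obtains m :: nat where "m \<ge> 1" "c * real Q \<le> real m" "m \<le> 2 * Q"
    "real m * dist_nearest_int (real m * \<alpha>) \<le> 6" "\<epsilon> \<le> dist_nearest_int (real m * L)"
proof -
  obtain q p where q: "q > 0" "coprime p (int q)" "q \<le> Q" "c * real Q \<le> real q"
    "\<bar>real q * \<alpha> - of_int p\<bar> \<le> 1 / real Q" "\<bar>real q * \<alpha> - of_int p\<bar> \<le> 1 / real q"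
    using Dirichlet_approx_badly[OF bad Q] by blast
  obtain q' p' where q': "q \<le> q'" "q' < 2 * q" "int q' * p - p' * int q = 1"
    using unimodular_complement[OF q(1,2)] by blast
  define \<theta> where "\<theta> = real q * \<alpha> - of_int p"
  have \<theta>: "\<bar>\<theta>\<bar> \<le> 1 / real q" using q by (simp add: \<theta>_def)
  have det: "real q' * of_int p - of_int p' * real q = 1"
    using arg_cong[OF q'(3), of real_of_int] by simp
  have m1: "real q * dist_nearest_int (real q * \<alpha>) \<le> 6"
  proof -
    have "real q * dist_nearest_int (real q * \<alpha>) \<le> real q * (1 / real q)"
      using dist_nearest_int_le[of "real q * \<alpha>" p] \<theta> by (intro mult_left_mono) (auto simp: \<theta>_def)
    then show ?thesis using q by simp
  qed
  have m2: "real q' * dist_nearest_int (real q' * \<alpha>) \<le> 6"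
  proof -
    have "real q * (real q' * \<alpha> - of_int p') = real q' * \<theta> + 1"
      using det by (simp add: \<theta>_def algebra_simps)
    then have "real q * \<bar>real q' * \<alpha> - of_int p'\<bar> = \<bar>real q' * \<theta> + 1\<bar>"
      by (metis abs_mult abs_of_nat)
    also have "\<dots> \<le> real q' * \<bar>\<theta>\<bar> + 1"
      using abs_triangle_ineq[of "real q' * \<theta>" 1] by (simp add: abs_mult)
    also have "real q' * \<bar>\<theta>\<bar> \<le> (2 * real q) * (1 / real q)"
      using q' \<theta> by (intro mult_mono) auto
    finally have *: "real q * \<bar>real q' * \<alpha> - of_int p'\<bar> \<le> 3"
      using q by simp
    have "real q' * dist_nearest_int (real q' * \<alpha>) \<le> (2 * real q) * \<bar>real q' * \<alpha> - of_int p'\<bar>"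
      using q' dist_nearest_int_le by (intro mult_mono) auto
    with * show ?thesis by linarith
  qed
  have "\<epsilon> \<le> dist_nearest_int (real q * L) \<or> \<epsilon> \<le> dist_nearest_int (real q' * L)"
  proof (rule ccontr)
    assume small: "\<not> ?thesis"
    define s s' where "s = round (real q * L)" and "s' = round (real q' * L)"
    define \<delta> \<delta>' where "\<delta> = real q * L - of_int s" and "\<delta>' = real q' * L - of_int s'"
    have \<delta>: "\<bar>\<delta>\<bar> \<le> \<epsilon>" "\<bar>\<delta>'\<bar> \<le> \<epsilon>"
      using small by (auto simp: dist_nearest_int_def \<delta>_def \<delta>'_def s_def s'_def)
    (* Cramer's rule for n p + l q = s and n p' + l q' = s', whose determinant is 1. *)
    define n l where "n = s * int q' - s' * int q" and "l = p * s' - p' * s"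
    have "n * p + l * int q = s * (int q' * p - p' * int q)"
      by (simp add: n_def l_def algebra_simps)
    then have "n * p + l * int q = s" using q' by simp
    from arg_cong[OF this, of real_of_int] have nl: "real_of_int n * of_int p + of_int l * real q = of_int s" by simp
    have "real_of_int n = \<delta>' * real q - \<delta> * real q'"
      by (simp add: n_def \<delta>_def \<delta>'_def algebra_simps)
    then have "\<bar>real_of_int n\<bar> \<le> \<bar>\<delta>'\<bar> * real q + \<bar>\<delta>\<bar> * real q'"
      using abs_triangle_ineq4[of "\<delta>' * real q" "\<delta> * real q'"] by (simp add: abs_mult)
    also have "\<dots> \<le> \<epsilon> * real q + \<epsilon> * (2 * real q)"
      using \<delta> q' \<epsilon> by (intro add_mono mult_mono) auto
    finally have n: "\<bar>real_of_int n\<bar> \<le> 3 * \<epsilon> * real q" by simp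
    have "real q * (L - of_int n * \<alpha> - of_int l) = \<delta> - of_int n * \<theta>"
      using nl by (simp add: \<delta>_def \<theta>_def algebra_simps)
    then have "real q * \<bar>L - of_int n * \<alpha> - of_int l\<bar> = \<bar>\<delta> - of_int n * \<theta>\<bar>"
      by (metis abs_mult abs_of_nat)
    also have "\<dots> \<le> \<bar>\<delta>\<bar> + \<bar>real_of_int n\<bar> * \<bar>\<theta>\<bar>"
      using abs_triangle_ineq4[of \<delta> "of_int n * \<theta>"] by (simp add: abs_mult)
    also have "\<dots> \<le> \<epsilon> + (3 * \<epsilon> * real q) * (1 / real q)"
      using \<delta> n \<theta> \<epsilon> by (intro add_mono mult_mono) auto
    finally have x: "real q * \<bar>L - of_int n * \<alpha> - of_int l\<bar> \<le> 4 * \<epsilon>" using q by simp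
    show False
    proof (cases "n = 0")
      case False
      have "dist_nearest_int (of_int n * \<alpha> - L) \<le> \<bar>L - of_int n * \<alpha> - of_int l\<bar>"
        using dist_nearest_int_le[of "of_int n * \<alpha> - L" "- l"] by simp
      with inhom[OF False] have "c' \<le> \<bar>of_int n\<bar> * \<bar>L - of_int n * \<alpha> - of_int l\<bar>"
        by (meson abs_ge_zero mult_left_mono order.trans)
      also have "\<dots> \<le> (3 * \<epsilon> * real q) * \<bar>L - of_int n * \<alpha> - of_int l\<bar>"
        using n by (intro mult_right_mono) auto
      also have "\<dots> = 3 * \<epsilon> * (real q * \<bar>L - of_int n * \<alpha> - of_int l\<bar>)" by simp
      also have "\<dots> \<le> 3 * \<epsilon> * (4 * \<epsilon>)"
        using x \<epsilon> by (intro mult_left_mono) auto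
      finally show False using \<epsilon> by (simp add: power2_eq_square)
    next
      case True
      have "1 * \<bar>L - of_int l\<bar> \<le> real q * \<bar>L - of_int l\<bar>"
        using q by (intro mult_right_mono) auto
      with x True have "\<bar>L - of_int l\<bar> \<le> 4 * \<epsilon>" by simp
      moreover have "l \<le> 0 \<or> l \<ge> 1" by linarith
      then have "real_of_int l \<le> 0 \<or> real_of_int l \<ge> 1" by auto
      ultimately show False using \<epsilon> by auto
    qed
  qed
  then show ?thesis
    using that[of q] that[of q'] m1 m2 q q' by auto
qed

text \<open>One multiple for each scale \<open>R ^ j \<le> X\<close>. The ratio \<open>R > 2 / c\<close> makes the ranges
  \<open>[c R ^ j, 2 R ^ j]\<close> disjoint, so that the multiples are distinct.\<close>

lemma exists_many_resonant_multiples: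
  fixes L :: real
  assumes c: "0 < c" "c \<le> 1 / 2" and bad: "\<And>n::int. n \<noteq> 0 \<Longrightarrow> c \<le> \<bar>of_int n\<bar> * dist_nearest_int (of_int n * \<alpha>)"
    and inhom: "\<And>n::int. n \<noteq> 0 \<Longrightarrow> c' \<le> \<bar>of_int n\<bar> * dist_nearest_int (of_int n * \<alpha> - L)"
    and \<epsilon>: "0 < \<epsilon>" "12 * \<epsilon>\<^sup>2 < c'" "4 * \<epsilon> < L" "4 * \<epsilon> < 1 - L"
    and X: "X > 0" and R: "real R > 2 / c"
  obtains G :: "nat set" where "finite G" "ln X / ln (real R) \<le> real (card G)"
    "\<And>m. m \<in> G \<Longrightarrow> m \<ge> 1 \<and> real m \<le> 2 * X \<and> real m * dist_nearest_int (real m * \<alpha>) \<le> 6 \<and> \<epsilon> \<le> dist_nearest_int (real m * L)"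
proof -
  have "2 / c \<ge> 4" using c by (simp add: field_simps)
  with R have R1: "real R > 1" by linarith
  have cR: "2 < c * real R" using R c by (simp add: field_simps)
  have "\<exists>m. m \<ge> 1 \<and> c * real (R ^ j) \<le> real m \<and> m \<le> 2 * R ^ j \<and>
    real m * dist_nearest_int (real m * \<alpha>) \<le> 6 \<and> \<epsilon> \<le> dist_nearest_int (real m * L)" for j
    using exists_resonant_multiple[OF bad inhom \<epsilon>, of "R ^ j"] R1 by (metis of_nat_0_less_iff zero_less_power zero_less_one less_trans)
  then obtain m where m: "\<And>j. m j \<ge> 1" "\<And>j. c * real (R ^ j) \<le> real (m j)" "\<And>j. m j \<le> 2 * R ^ j"
    "\<And>j. real (m j) * dist_nearest_int (real (m j) * \<alpha>) \<le> 6" "\<And>j. \<epsilon> \<le> dist_nearest_int (real (m j) * L)"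
    by metis
  have m3: "real (m j) \<le> 2 * real R ^ j" for j
    using m(3)[of j] by (metis of_nat_le_iff of_nat_mult of_nat_numeral of_nat_power)
  have "m i < m j" if "i < j" for i j
  proof -
    have "real (m i) \<le> 2 * real R ^ i" by (rule m3)
    also have "\<dots> < (c * real R) * real R ^ i"
      using cR R1 by (intro mult_strict_right_mono) auto
    also have "\<dots> = c * real R ^ Suc i" by simp
    also have "\<dots> \<le> c * real R ^ j"
      using that R1 c by (intro mult_left_mono power_increasing) auto
    also have "\<dots> \<le> real (m j)" using m(2)[of j] by simp
    finally show ?thesis by simp
  qed
  then have "inj m" by (metis linorder_injI less_irrefl)
  (* The number of j with R ^ j \<le> X; it is 0 when X < 1. *)
  define k where "k = nat (\<lfloor>log (real R) X\<rfloor> + 1)"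
  show ?thesis
  proof (rule that[of "m ` {..<k}"])
    have "card (m ` {..<k}) = k"
      using \<open>inj m\<close> by (simp add: card_image inj_on_subset)
    moreover have "ln X / ln (real R) \<le> real k"
      unfolding k_def by (simp flip: log_def) linarith
    ultimately show "ln X / ln (real R) \<le> real (card (m ` {..<k}))" by simp
  next
    fix n assume "n \<in> m ` {..<k}"
    then obtain j where j: "n = m j" "j < k" by auto
    then have "int j \<le> \<lfloor>log (real R) X\<rfloor>" by (simp add: k_def)
    then have "real j \<le> log (real R) X" by linarith
    then have "real R powr real j \<le> X"
      using R1 X by (simp add: le_log_iff)
    then have "real R ^ j \<le> X" using R1 by (simp add: powr_realpow)
    with m3[of j] have "real (m j) \<le> 2 * X" by linarith
    then show "n \<ge> 1 \<and> real n \<le> 2 * X \<and> real n * dist_nearest_int (real n * \<alpha>) \<le> 6 \<and> \<epsilon> \<le> dist_nearest_int (real n * L)"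
      using m j by auto
  qed simp
qed

text \<open>Each \<open>m\<close> in \<open>G\<close> contributes at least \<open>(\<epsilon> q / 343)\<^sup>2\<close> to the sum over the frequencies: the numerator
  stays above \<open>\<epsilon>\<close>, since replacing \<open>L\<close> by \<open>l / q\<close> costs at most \<open>m / q \<le> \<epsilon> / 2\<close>, and the denominator
  is at most \<open>(7 m / q) (49 / m) = 343 / q\<close>.\<close>

lemma arc_discrepancy_variance_ge:
  fixes L :: real
  assumes c: "0 < c" "c \<le> 1 / 2" and bad: "\<And>n::int. n \<noteq> 0 \<Longrightarrow> c \<le> \<bar>of_int n\<bar> * dist_nearest_int (of_int n * \<alpha>)"
    and q: "q > 0" "coprime p (int q)" and p: "\<bar>real q * \<alpha> - of_int p\<bar> \<le> 1 / real q"
    and Al: "A + l \<le> q" and \<mu>: "\<mu> = (\<Sum>N=1..q. arc_discrepancy q p A l N) / real q"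
    and l: "l = nat \<lfloor>L * real q\<rfloor>" and L: "0 \<le> L"
    and \<epsilon>: "0 < \<epsilon>" "\<epsilon> < 1" and G: "finite G" 
    "\<And>m. m \<in> G \<Longrightarrow> m \<ge> 1 \<and> real m \<le> \<epsilon> / 2 * real q \<and> real m * dist_nearest_int (real m * \<alpha>) \<le> 6 \<and> \<epsilon> \<le> dist_nearest_int (real m * L)"
  shows "(\<epsilon> / 343)\<^sup>2 * real q * real (card G) \<le> (\<Sum>N=1..q. (arc_discrepancy q p A l N - \<mu>)\<^sup>2)"
proof -
  let ?f = "\<lambda>m. (cmod (e (real m * real l / real q) - 1) /
            (cmod (e (real m / real q) - 1) * cmod (e (real m * of_int p / real q) - 1)))\<^sup>2"
  have "real m < 1 * real q" if "m \<in> G" for m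
  proof -
    have "real m \<le> \<epsilon> / 2 * real q" using G(2)[OF that] by simp
    also have "\<dots> < 1 * real q" using \<epsilon> q by (intro mult_strict_right_mono) auto
    finally show ?thesis .
  qed
  then have Gq: "G \<subseteq> {1..<q}" using G(2) by fastforce
  have f: "(\<epsilon> * real q / 343)\<^sup>2 \<le> ?f m" if mG: "m \<in> G" for m
  proof -
    have m: "m \<ge> 1" "m < q" "real m \<le> \<epsilon> / 2 * real q" "real m * dist_nearest_int (real m * \<alpha>) \<le> 6" "\<epsilon> \<le> dist_nearest_int (real m * L)"
      using G(2)[OF mG] mG Gq by auto
    let ?u = "dist_nearest_int (real m / real q)" and ?v = "dist_nearest_int (real m * of_int p / real q)"
    have "1 / real q > 0" using q by simp
    have "\<not> q dvd m" using m by (auto dest: dvd_imp_le)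
    then have "1 / real q \<le> ?u"
      using dist_nearest_int_rational_ge[OF q(1), of "int m"] by simp
    then have u: "?u > 0" using \<open>1 / real q > 0\<close> by linarith
    have "0 < c / 2 / real m" using c m by simp
    also have "\<dots> \<le> ?v" using m by (intro dist_nearest_int_convergent_ge[OF c bad q p]) auto
    finally have v: "?v > 0" .
    have u': "?u \<le> real m / real q"
      using dist_nearest_int_le[of "real m / real q" 0] by simp
    have "?v \<le> dist_nearest_int (real m * \<alpha>) + real m / (real q)\<^sup>2"
      using dist_nearest_int_lipschitz[of "real m * of_int p / real q" "real m * \<alpha>"] mult_rational_approx[OF q(1) p, of m]
      by (simp add: abs_minus_commute)
    also have "dist_nearest_int (real m * \<alpha>) \<le> 6 / real m"
      using m by (simp add: field_simps)
    also have "real m / (real q)\<^sup>2 \<le> 1 / real m"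
      using m power_mono[of "real m" "real q" 2] by (simp add: field_simps power2_eq_square)
    finally have v': "?v \<le> 7 / real m" by simp
    have l': "real l \<le> L * real q" "L * real q < real l + 1"
      using L by (auto simp: l of_nat_nat)
    have "\<bar>real m * L - real m * real l / real q\<bar> = real m / real q * \<bar>L * real q - real l\<bar>"
    proof -
      have "real m * L - real m * real l / real q = real m / real q * (L * real q - real l)"
        using q by (simp add: field_simps)
      then show ?thesis by (simp only: abs_mult) simp
    qed
    also have "\<dots> \<le> real m / real q * 1"
      using l' by (intro mult_left_mono) auto
    also have "\<dots> \<le> \<epsilon> / 2" using m q by (simp add: field_simps)
    finally have w: "\<epsilon> / 2 \<le> dist_nearest_int (real m * real l / real q)"
      using dist_nearest_int_lipschitz[of "real m * L" "real m * real l / real q"] m by linarith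
    have cu: "0 < cmod (e (real m / real q) - 1)" "cmod (e (real m / real q) - 1) \<le> 7 * (real m / real q)"
      using dist_nearest_int_chord[of "real m / real q"] u u' by linarith+
    have cv: "0 < cmod (e (real m * of_int p / real q) - 1)" "cmod (e (real m * of_int p / real q) - 1) \<le> 7 * (7 / real m)"
      using dist_nearest_int_chord[of "real m * of_int p / real q"] v v' by linarith+
    have "\<epsilon> * real q / 343 = \<epsilon> / ((7 * (real m / real q)) * (7 * (7 / real m)))"
      using m q by (simp add: field_simps)
    also have "\<dots> \<le> cmod (e (real m * real l / real q) - 1) /
            (cmod (e (real m / real q) - 1) * cmod (e (real m * of_int p / real q) - 1))"
      using cu cv w dist_nearest_int_chord(1)[of "real m * real l / real q"]
      by (intro frac_le mult_mono) auto
    finally show ?thesis using \<epsilon> q by (intro power_mono) auto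
  qed
  have "(\<epsilon> / 343)\<^sup>2 * real q * real (card G) = (\<Sum>m\<in>G. (\<epsilon> * real q / 343)\<^sup>2) / real q"
    using q by (simp add: power2_eq_square)
  also have "\<dots> \<le> (\<Sum>m\<in>G. ?f m) / real q"
    by (intro divide_right_mono sum_mono f) auto
  also have "\<dots> \<le> (\<Sum>m=1..<q. ?f m) / real q"
    using Gq by (intro divide_right_mono sum_mono2) auto
  also have "\<dots> = (\<Sum>N=1..q. (arc_discrepancy q p A l N - \<mu>)\<^sup>2)"
    by (rule arc_discrepancy_variance[OF q Al \<mu>, symmetric])
  finally show ?thesis .
qed

section \<open>Transfer to the Birkhoff sums\<close>

text \<open>The mean minimises the sum of squared deviations; this is what allows the mean over \<open>N \<le> M\<close> and
  the mean over a period to be exchanged, in either direction.\<close>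

lemma sum_sq_dev_mean_le:
  fixes x :: "'a \<Rightarrow> real"
  assumes "finite I" "A * real (card I) = (\<Sum>i\<in>I. x i)"
  shows "(\<Sum>i\<in>I. (x i - A)\<^sup>2) \<le> (\<Sum>i\<in>I. (x i - t)\<^sup>2)"
proof -
  have "(\<Sum>i\<in>I. (x i - t)\<^sup>2) = (\<Sum>i\<in>I. (x i - A)\<^sup>2 + 2 * (A - t) * (x i - A) + (A - t)\<^sup>2)"
    by (intro sum.cong refl) (simp add: power2_eq_square algebra_simps)
  also have "\<dots> = (\<Sum>i\<in>I. (x i - A)\<^sup>2) + 2 * (A - t) * (\<Sum>i\<in>I. x i - A) + real (card I) * (A - t)\<^sup>2"
    by (simp add: sum.distrib sum_distrib_left)
  also have "(\<Sum>i\<in>I. x i - A) = 0"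
    using assms by (simp add: sum_subtractf mult.commute)
  finally show ?thesis by simp
qed

lemma sum_sq_dev_perturb:
  fixes x y :: "'a \<Rightarrow> real"
  assumes "\<And>i. i \<in> I \<Longrightarrow> \<bar>x i - y i\<bar> \<le> D"
  shows "(\<Sum>i\<in>I. (x i - t)\<^sup>2) \<le> 2 * (\<Sum>i\<in>I. (y i - t)\<^sup>2) + 2 * D\<^sup>2 * real (card I)"
proof -
  have "(x i - t)\<^sup>2 \<le> 2 * (y i - t)\<^sup>2 + 2 * D\<^sup>2" if "i \<in> I" for i
  proof -
    have "(x i - y i)\<^sup>2 \<le> D\<^sup>2"
      using power_mono[OF assms[OF that], of 2] by simp
    moreover have "(x i - t)\<^sup>2 \<le> 2 * (y i - t)\<^sup>2 + 2 * (x i - y i)\<^sup>2"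
      using zero_le_power2[of "(x i - y i) - (y i - t)"] by (simp add: power2_eq_square algebra_simps)
    ultimately show ?thesis by linarith
  qed
  then have "(\<Sum>i\<in>I. (x i - t)\<^sup>2) \<le> (\<Sum>i\<in>I. 2 * (y i - t)\<^sup>2 + 2 * D\<^sup>2)"
    by (rule sum_mono)
  then show ?thesis by (simp add: sum.distrib sum_distrib_left mult.commute)
qed

lemma birkhoff_variance_eq:
  "M > 0 \<Longrightarrow> real M * birkhoff_variance \<alpha> f M = (\<Sum>N=1..M. (birkhoff_sum \<alpha> f N - birkhoff_mean \<alpha> f M)\<^sup>2)"
  by (simp add: birkhoff_variance_def)

lemma birkhoff_mean_eq:
  "M > 0 \<Longrightarrow> birkhoff_mean \<alpha> f M * real (card {1..M}) = (\<Sum>N=1..M. birkhoff_sum \<alpha> f N)"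
  by (simp add: birkhoff_mean_def)

lemma birkhoff_variance_nonneg: "birkhoff_variance \<alpha> f M \<ge> 0"
  by (simp add: birkhoff_variance_def sum_nonneg)

lemma rounded_interval_le:
  fixes a b :: real
  assumes "0 \<le> a" "a \<le> b" "b \<le> 1"
  shows "nat \<lfloor>a * real q\<rfloor> + nat \<lfloor>(b - a) * real q\<rfloor> \<le> q"
proof -
  have "real (nat \<lfloor>a * real q\<rfloor>) \<le> a * real q" "real (nat \<lfloor>(b - a) * real q\<rfloor>) \<le> (b - a) * real q"
    using assms by (auto intro!: of_nat_floor)
  then have "real (nat \<lfloor>a * real q\<rfloor>) + real (nat \<lfloor>(b - a) * real q\<rfloor>) \<le> b * real q"
    by (simp add: algebra_simps)
  also have "\<dots> \<le> 1 * real q" using assms by (intro mult_right_mono) auto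
  finally show ?thesis by linarith
qed

text \<open>Enlarging the range \<open>N \<le> M\<close> to a full period \<open>q\<close> with \<open>M \<le> q \<le> 2 M / c\<close> only adds nonnegative
  terms.\<close>

lemma birkhoff_variance_upper:
  assumes c: "0 < c" "c \<le> 1 / 2" and bad: "\<And>n::int. n \<noteq> 0 \<Longrightarrow> c \<le> \<bar>of_int n\<bar> * dist_nearest_int (of_int n * \<alpha>)"
    and ab: "0 \<le> a" "a \<le> b" "b \<le> 1" and M: "M > 0"
  shows "birkhoff_variance \<alpha> (interval_discrepancy_fun a b) M
    \<le> 32 / c ^ 3 * (1 + 2 * ln (2 * real M / c)) + 2 * (12 / c + 3)\<^sup>2"
proof -
  let ?S = "birkhoff_sum \<alpha> (interval_discrepancy_fun a b)"
  define D where "D = 12 / c + 3"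
  define Q where "Q = nat \<lceil>real M / c\<rceil>"
  have "real M / c \<ge> 1" using c M by (simp add: field_simps)
  then have Q: "Q > 0" "real M / c \<le> real Q" "real Q \<le> 2 * real M / c"
  proof -
    have "real Q = of_int \<lceil>real M / c\<rceil>"
      unfolding Q_def using \<open>real M / c \<ge> 1\<close> by (intro of_nat_nat) linarith
    moreover have "2 * real M / c = 2 * (real M / c)" by simp
    ultimately show "real M / c \<le> real Q" "real Q \<le> 2 * real M / c"
      using \<open>real M / c \<ge> 1\<close> by linarith+
    then show "Q > 0" using \<open>real M / c \<ge> 1\<close> by (cases "Q = 0") auto
  qed
  obtain q p where q: "q > 0" "coprime p (int q)" "q \<le> Q" "c * real Q \<le> real q"
    "\<bar>real q * \<alpha> - of_int p\<bar> \<le> 1 / real Q" "\<bar>real q * \<alpha> - of_int p\<bar> \<le> 1 / real q"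
    using Dirichlet_approx_badly[OF bad Q(1)] by blast
  have "real M \<le> c * real Q" using Q c by (simp add: field_simps)
  with q have Mq: "M \<le> q" by linarith
  have qM: "real q \<le> 2 * real M / c" using q Q by linarith
  define A l where "A = nat \<lfloor>a * real q\<rfloor>" and "l = nat \<lfloor>(b - a) * real q\<rfloor>"
  have Al: "A + l \<le> q" unfolding A_def l_def by (rule rounded_interval_le[OF ab])
  define t where "t = (\<Sum>N=1..q. arc_discrepancy q p A l N) / real q"
  have close: "\<bar>?S N - arc_discrepancy q p A l N\<bar> \<le> D" if "N \<in> {1..M}" for N
    using birkhoff_sum_close[OF c(1) bad q(1) q(6) ab A_def l_def, of N] that Mq by (simp add: D_def)
  have "real M * birkhoff_variance \<alpha> (interval_discrepancy_fun a b) M \<le> (\<Sum>N=1..M. (?S N - t)\<^sup>2)"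
    unfolding birkhoff_variance_eq[OF M] by (rule sum_sq_dev_mean_le[OF _ birkhoff_mean_eq[OF M]]) simp
  also have "\<dots> \<le> 2 * (\<Sum>N=1..M. (arc_discrepancy q p A l N - t)\<^sup>2) + 2 * D\<^sup>2 * real (card {1..M})"
    by (rule sum_sq_dev_perturb[OF close])
  also have "(\<Sum>N=1..M. (arc_discrepancy q p A l N - t)\<^sup>2) \<le> (\<Sum>N=1..q. (arc_discrepancy q p A l N - t)\<^sup>2)"
    using Mq by (intro sum_mono2) auto
  also have "\<dots> \<le> 8 / c\<^sup>2 * real q * (1 + 2 * ln (real q))"
    by (rule arc_discrepancy_variance_le[OF c bad q(1,2,6) Al t_def])
  also have "\<dots> \<le> 8 / c\<^sup>2 * (2 * real M / c) * (1 + 2 * ln (2 * real M / c))"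
    using q qM c by (intro mult_mono add_mono order.refl) auto
  also have "2 * (8 / c\<^sup>2 * (2 * real M / c) * (1 + 2 * ln (2 * real M / c))) + 2 * D\<^sup>2 * real (card {1..M})
    = real M * (32 / c ^ 3 * (1 + 2 * ln (2 * real M / c)) + 2 * D\<^sup>2)"
  proof -
    have "2 * (8 / c\<^sup>2 * (2 * real M / c) * w) + 2 * D\<^sup>2 * real (card {1..M}) = real M * (32 / c ^ 3 * w + 2 * D\<^sup>2)" for w
      using c by (simp add: field_simps power2_eq_square power3_eq_cube)
    then show ?thesis .
  qed
  finally show ?thesis using M by (simp add: D_def)
qed

text \<open>Restricting the range \<open>N \<le> M\<close> to a full period \<open>q\<close> with \<open>c M \<le> q \<le> M\<close> only drops nonnegative
  terms. The left-hand side is informative for large \<open>M\<close> only; when its inner factor is negative the claim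
  is trivial.\<close>

lemma birkhoff_variance_lower:
  assumes c: "0 < c" "c \<le> 1 / 2" and bad: "\<And>n::int. n \<noteq> 0 \<Longrightarrow> c \<le> \<bar>of_int n\<bar> * dist_nearest_int (of_int n * \<alpha>)"
    and inhom: "\<And>n::int. n \<noteq> 0 \<Longrightarrow> c' \<le> \<bar>of_int n\<bar> * dist_nearest_int (of_int n * \<alpha> - (b - a))"
    and \<epsilon>: "0 < \<epsilon>" "12 * \<epsilon>\<^sup>2 < c'" "4 * \<epsilon> < b - a" "4 * \<epsilon> < 1 - (b - a)"
    and R: "real R > 2 / c"
    and ab: "0 \<le> a" "a \<le> b" "b \<le> 1" and M: "M > 0"
  shows "c * ((\<epsilon> / 343)\<^sup>2 * (ln (c * \<epsilon> / 4 * real M) / ln (real R)) / 2 - (12 / c + 3)\<^sup>2)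
    \<le> birkhoff_variance \<alpha> (interval_discrepancy_fun a b) M"
proof -
  let ?S = "birkhoff_sum \<alpha> (interval_discrepancy_fun a b)"
  let ?V = "birkhoff_variance \<alpha> (interval_discrepancy_fun a b) M"
  define D where "D = 12 / c + 3"
  define Y where "Y = (\<epsilon> / 343)\<^sup>2 * (ln (c * \<epsilon> / 4 * real M) / ln (real R)) / 2 - D\<^sup>2"
  have "c * Y \<le> ?V"
  proof (cases "Y \<ge> 0")
    case False
    then have "c * Y \<le> 0" using c by (simp add: mult_le_0_iff)
    then show ?thesis using birkhoff_variance_nonneg order.trans by blast
  next
    case True
    obtain q p where q: "q > 0" "coprime p (int q)" "q \<le> M" "c * real M \<le> real q"
      "\<bar>real q * \<alpha> - of_int p\<bar> \<le> 1 / real M" "\<bar>real q * \<alpha> - of_int p\<bar> \<le> 1 / real q"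
      using Dirichlet_approx_badly[OF bad M] by blast
    define A l where "A = nat \<lfloor>a * real q\<rfloor>" and "l = nat \<lfloor>(b - a) * real q\<rfloor>"
    have Al: "A + l \<le> q" unfolding A_def l_def by (rule rounded_interval_le[OF ab])
    define t where "t = (\<Sum>N=1..q. arc_discrepancy q p A l N) / real q"
    define B where "B = birkhoff_mean \<alpha> (interval_discrepancy_fun a b) M"
    have "\<epsilon> / 4 * real q > 0" using \<epsilon> q by simp
    from exists_many_resonant_multiples[OF c bad inhom \<epsilon> this R]
    obtain G where G: "finite G" "ln (\<epsilon> / 4 * real q) / ln (real R) \<le> real (card G)"
      "\<And>m. m \<in> G \<Longrightarrow> m \<ge> 1 \<and> real m \<le> 2 * (\<epsilon> / 4 * real q) \<and> real m * dist_nearest_int (real m * \<alpha>) \<le> 6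
         \<and> \<epsilon> \<le> dist_nearest_int (real m * (b - a))"
      by blast
    have "2 / c \<ge> 4" using c by (simp add: field_simps)
    with R have R1: "real R > 1" by linarith
    have "ln (c * \<epsilon> / 4 * real M) \<le> ln (\<epsilon> / 4 * real q)"
      using q c \<epsilon> M by (subst ln_le_cancel_iff) (auto simp: field_simps)
    then have "ln (c * \<epsilon> / 4 * real M) / ln (real R) \<le> ln (\<epsilon> / 4 * real q) / ln (real R)"
      using R1 by (intro divide_right_mono) auto
    with G(2) have card: "ln (c * \<epsilon> / 4 * real M) / ln (real R) \<le> real (card G)" by linarith
    have "(\<epsilon> / 343)\<^sup>2 * real q * (ln (c * \<epsilon> / 4 * real M) / ln (real R)) \<le> (\<epsilon> / 343)\<^sup>2 * real q * real (card G)"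
      by (rule mult_left_mono[OF card]) auto
    also have "\<dots> \<le> (\<Sum>N=1..q. (arc_discrepancy q p A l N - t)\<^sup>2)"
      using \<epsilon> ab G by (intro arc_discrepancy_variance_ge[OF c bad q(1,2,6) Al t_def l_def]) auto
    also have "\<dots> \<le> (\<Sum>N=1..q. (arc_discrepancy q p A l N - B)\<^sup>2)"
      by (rule sum_sq_dev_mean_le) (use q in \<open>auto simp: t_def\<close>)
    also have "\<dots> \<le> 2 * (\<Sum>N=1..q. (?S N - B)\<^sup>2) + 2 * D\<^sup>2 * real (card {1..q})"
      using birkhoff_sum_close[OF c(1) bad q(1) q(6) ab A_def l_def]
      by (intro sum_sq_dev_perturb) (simp add: D_def abs_minus_commute)
    also have "(\<Sum>N=1..q. (?S N - B)\<^sup>2) \<le> (\<Sum>N=1..M. (?S N - B)\<^sup>2)"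
      using q by (intro sum_mono2) auto
    also have "\<dots> = real M * ?V"
      unfolding birkhoff_variance_eq[OF M] B_def ..
    finally have le: "(\<epsilon> / 343)\<^sup>2 * real q * (ln (c * \<epsilon> / 4 * real M) / ln (real R)) \<le> 2 * (real M * ?V) + 2 * D\<^sup>2 * real (card {1..q})"
      by simp
    have "real q * Y \<le> real M * ?V"
    proof -
      define Z where "Z = (\<epsilon> / 343)\<^sup>2 * (ln (c * \<epsilon> / 4 * real M) / ln (real R))"
      from le have "real q * Z \<le> 2 * (real M * ?V) + 2 * (real q * D\<^sup>2)"
        by (simp only: Z_def card_atLeastAtMost) (simp add: mult_ac)
      moreover have "real q * Y = real q * Z / 2 - real q * D\<^sup>2"
        unfolding Y_def Z_def[symmetric] by (simp add: right_diff_distrib)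
      ultimately show "real q * Y \<le> real M * ?V" by linarith
    qed
    moreover have "c * real M * Y \<le> real q * Y"
      using q True by (intro mult_right_mono) auto
    ultimately have "real M * (c * Y) \<le> real M * ?V" by (simp add: mult_ac)
    then show ?thesis using M by simp
  qed
  then show ?thesis by (simp add: Y_def D_def)
qed

text \<open>The sums \<open>S\<^sub>1\<close> and \<open>S\<^sub>2\<close> differ by a value of the function, which is \<open>1 - L\<close> or \<open>- L\<close> and never
  small. This covers the small \<open>M\<close>, for which the logarithmic bound is void.\<close>

lemma birkhoff_variance_ge_inverse:
  assumes L: "0 < b - a" "b - a < 1" and M: "M \<ge> 2"
  shows "(min (b - a) (1 - (b - a)))\<^sup>2 / 2 / real M \<le> birkhoff_variance \<alpha> (interval_discrepancy_fun a b) M"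
proof -
  let ?S = "birkhoff_sum \<alpha> (interval_discrepancy_fun a b)"
  define A where "A = birkhoff_mean \<alpha> (interval_discrepancy_fun a b) M"
  define f where "f = interval_discrepancy_fun a b (2 * \<alpha>)"
  have S: "?S 2 - ?S 1 = f"
    by (simp add: birkhoff_sum_def f_def numeral_2_eq_2)
  have "min (b - a) (1 - (b - a)) \<le> \<bar>f\<bar>"
    using L by (auto simp: f_def interval_discrepancy_fun_def indicator_def)
  then have "(min (b - a) (1 - (b - a)))\<^sup>2 \<le> \<bar>f\<bar>\<^sup>2"
    using L by (intro power_mono) auto
  also have "\<dots> \<le> 2 * ((?S 1 - A)\<^sup>2 + (?S 2 - A)\<^sup>2)"
    unfolding S[symmetric] using zero_le_power2[of "(?S 1 - A) + (?S 2 - A)"]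
    by (simp add: power2_eq_square algebra_simps)
  also have "(?S 1 - A)\<^sup>2 + (?S 2 - A)\<^sup>2 = (\<Sum>N\<in>{1,2}. (?S N - A)\<^sup>2)" by simp
  also have "\<dots> \<le> (\<Sum>N=1..M. (?S N - A)\<^sup>2)"
    using M by (intro sum_mono2) auto
  also have "\<dots> = real M * birkhoff_variance \<alpha> (interval_discrepancy_fun a b) M"
    using M by (simp add: birkhoff_variance_eq A_def)
  finally show ?thesis using M by (simp add: field_simps)
qed

text \<open>With \<open>x = ln M\<close>: the bound \<open>\<kappa> x - K\<close> suffices once \<open>x\<close> exceeds \<open>2 |K| / \<kappa>\<close>, and the finitely many
  smaller \<open>M\<close> are handled by \<open>\<nu> / M\<close>.\<close>

lemma log_lower_bound:
  fixes \<kappa> K \<nu> :: real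
  assumes "\<kappa> > 0" "\<nu> > 0"
  obtains c where "c > 0" "\<And>x v. x > 0 \<Longrightarrow> \<kappa> * x - K \<le> v \<Longrightarrow> \<nu> / exp x \<le> v \<Longrightarrow> c * x \<le> v"
proof -
  (* The summand 1 keeps E positive when K = 0. *)
  define E where "E = 2 * \<bar>K\<bar> / \<kappa> + 1"
  have E: "E > 0" using assms by (simp add: E_def add_nonneg_pos)
  define c where "c = min (\<kappa> / 2) (\<nu> / exp E / E)"
  have "c > 0" using assms E by (simp add: c_def)
  moreover have "c * x \<le> v" if x: "x > 0" and v: "\<kappa> * x - K \<le> v" "\<nu> / exp x \<le> v" for x v
  proof (cases "x \<le> E")
    case True
    have "c * x \<le> (\<nu> / exp E / E) * E"
      using True x assms E by (intro mult_mono) (auto simp: c_def)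
    also have "\<dots> = \<nu> / exp E" using E by simp
    also have "\<dots> \<le> \<nu> / exp x" using True assms by (intro divide_left_mono) auto
    finally show ?thesis using v by linarith
  next
    case False
    then have "\<kappa> * (2 * \<bar>K\<bar> / \<kappa>) \<le> \<kappa> * x"
      using assms by (intro mult_left_mono) (auto simp: E_def)
    then have "2 * \<bar>K\<bar> \<le> \<kappa> * x" using assms by simp
    then have "\<kappa> / 2 * x \<le> \<kappa> * x - K" by (simp add: abs_if split: if_splits)
    moreover have "c * x \<le> \<kappa> / 2 * x"
      unfolding c_def using x by (intro mult_right_mono min.cobounded1) simp
    ultimately show ?thesis using v by linarith
  qed
  ultimately show ?thesis using that by blast
qed

theorem theorem5:
  fixes \<alpha> L :: real
  assumes "badly_approximable \<alpha>"
    and "0 < L" and "L < 1"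
    and "\<forall>k\<in>{1, 3, 5, 7, 9::nat}.
      (INF q\<in>UNIV - {0::int}.
         \<bar>real_of_int q\<bar> * dist_nearest_int (real_of_int q * \<alpha> - real k * L)) > 0"
  shows "\<exists>c>0. \<exists>C>0. \<forall>a b::real. 0 \<le> a \<and> b \<le> 1 \<and> b - a = L \<longrightarrow>
    (\<forall>M::nat. M \<ge> 2 \<longrightarrow>
       c * ln (real M) \<le> birkhoff_variance \<alpha> (interval_discrepancy_fun a b) M \<and>
       birkhoff_variance \<alpha> (interval_discrepancy_fun a b) M \<le> C * ln (real M))"
proof -
  obtain c where c: "0 < c" "c \<le> 1 / 2"
    and bad: "\<And>n::int. n \<noteq> 0 \<Longrightarrow> c \<le> \<bar>of_int n\<bar> * dist_nearest_int (of_int n * \<alpha>)"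
    using badly_approximable_bound[OF assms(1)] by blast
  have "(INF q\<in>UNIV - {0::int}. \<bar>real_of_int q\<bar> * dist_nearest_int (real_of_int q * \<alpha> - L)) > 0"
    using assms(4) by simp
  then obtain c' where c': "c' > 0"
    and inhom: "\<And>n::int. n \<noteq> 0 \<Longrightarrow> c' \<le> \<bar>of_int n\<bar> * dist_nearest_int (of_int n * \<alpha> - L)"
    by (rule INF_pos_lower_bound) auto
  (* Since \<epsilon> < 1, the bound 12 \<epsilon> \<le> c' implies 12 \<epsilon>\<^sup>2 < c'. *)
  define \<epsilon> where "\<epsilon> = min (min (L / 5) ((1 - L) / 5)) (c' / 12)"
  have \<epsilon>: "0 < \<epsilon>" "4 * \<epsilon> < L" "4 * \<epsilon> < 1 - L" "12 * \<epsilon> \<le> c'"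
    using assms(2,3) c' by (auto simp: \<epsilon>_def min_def)
  have "12 * \<epsilon>\<^sup>2 = (12 * \<epsilon>) * \<epsilon>" by (simp add: power2_eq_square)
  also have "\<dots> < (12 * \<epsilon>) * 1" using \<epsilon> assms(3) by (intro mult_strict_left_mono) auto
  finally have \<epsilon>2: "12 * \<epsilon>\<^sup>2 < c'" using \<epsilon> by linarith
  obtain R :: nat where R: "real R > 2 / c"
    using reals_Archimedean2 by blast
  have "2 / c \<ge> 4" using c by (simp add: field_simps)
  with R have R1: "real R > 1" by linarith
  define \<kappa> where "\<kappa> = c * (\<epsilon> / 343)\<^sup>2 / ln (real R) / 2"
  define K where "K = c * (12 / c + 3)\<^sup>2 - \<kappa> * ln (c * \<epsilon> / 4)"
  define \<nu> where "\<nu> = (min L (1 - L))\<^sup>2 / 2"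
  have "\<kappa> > 0" using c \<epsilon> R1 by (simp add: \<kappa>_def)
  moreover have "\<nu> > 0" using assms(2,3) by (simp add: \<nu>_def)
  ultimately obtain c0 where c0: "c0 > 0"
    "\<And>x v. x > 0 \<Longrightarrow> \<kappa> * x - K \<le> v \<Longrightarrow> \<nu> / exp x \<le> v \<Longrightarrow> c0 * x \<le> v"
    using log_lower_bound[of \<kappa> \<nu> K] by blast
  define C where "C = 32 / c ^ 3 * (2 + 4 * ln (2 / c) + 2) + 4 * (12 / c + 3)\<^sup>2"
  have lnc: "ln (2 / c) \<ge> 0" using c by (simp add: field_simps)
  have "C > 0"
  proof -
    have "12 / c + 3 > 0" using c by (intro add_pos_pos) auto
    then have "4 * (12 / c + 3)\<^sup>2 > 0" by simp
    moreover have "32 / c ^ 3 * (2 + 4 * ln (2 / c) + 2) \<ge> 0" using c lnc by simp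
    ultimately show ?thesis unfolding C_def by (rule add_nonneg_pos[rotated])
  qed
  have main: "c0 * ln (real M) \<le> birkhoff_variance \<alpha> (interval_discrepancy_fun a b) M \<and>
       birkhoff_variance \<alpha> (interval_discrepancy_fun a b) M \<le> C * ln (real M)"
    if ab: "0 \<le> a" "b \<le> 1" "b - a = L" and M: "M \<ge> 2" for a b M
  proof
    let ?V = "birkhoff_variance \<alpha> (interval_discrepancy_fun a b) M"
    define x where "x = ln (real M)"
    have M0: "M > 0" "a \<le> b" using M ab assms by auto
    have "ln 2 \<le> x" using M by (simp add: x_def)
    moreover have "(1::real) / 2 \<le> ln 2"
      using ln_le_minus_one[of "1 / 2 :: real"] by (simp add: ln_div)
    ultimately have x: "x \<ge> 1 / 2" by linarith
    have "c * ((\<epsilon> / 343)\<^sup>2 * (ln (c * \<epsilon> / 4 * real M) / ln (real R)) / 2 - (12 / c + 3)\<^sup>2) \<le> ?V"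
      by (rule birkhoff_variance_lower[OF c bad _ \<epsilon>(1) \<epsilon>2 _ _ R ab(1) M0(2) ab(2) M0(1)])
         (use ab \<epsilon> inhom in auto)
    moreover have "ln (c * \<epsilon> / 4 * real M) = ln (c * \<epsilon> / 4) + x"
      unfolding x_def using c \<epsilon> M0 by (intro ln_mult_pos) auto
    moreover have "c * ((\<epsilon> / 343)\<^sup>2 * (y / ln (real R)) / 2 - (12 / c + 3)\<^sup>2) = \<kappa> * y - c * (12 / c + 3)\<^sup>2" for y
      by (simp add: \<kappa>_def right_diff_distrib)
    ultimately have "\<kappa> * (ln (c * \<epsilon> / 4) + x) - c * (12 / c + 3)\<^sup>2 \<le> ?V"
      by simp
    then have "\<kappa> * x - K \<le> ?V"
      by (simp add: K_def distrib_left)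
    moreover have "\<nu> / exp x \<le> ?V"
      using birkhoff_variance_ge_inverse[of b a M \<alpha>] ab assms(2,3) M by (simp add: \<nu>_def x_def)
    ultimately show "c0 * ln (real M) \<le> ?V"
      using c0(2)[of x ?V] x by (simp add: x_def)
    have "?V \<le> 32 / c ^ 3 * (1 + 2 * ln (2 * real M / c)) + 2 * (12 / c + 3)\<^sup>2"
      by (rule birkhoff_variance_upper[OF c bad ab(1) M0(2) ab(2) M0(1)])
    also have "ln (2 * real M / c) = ln (2 / c) + x"
      using ln_mult[of "2 / c" "real M"] c M0 by (simp add: x_def)
    also have "32 / c ^ 3 * (1 + 2 * (ln (2 / c) + x)) + 2 * (12 / c + 3)\<^sup>2
        \<le> 32 / c ^ 3 * ((2 + 4 * ln (2 / c) + 2) * x) + 4 * (12 / c + 3)\<^sup>2 * x"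
    proof (intro add_mono mult_left_mono)
      have "2 * ln (2 / c) * 1 \<le> 2 * ln (2 / c) * (2 * x)"
        using x lnc by (intro mult_left_mono) auto
      then show "1 + 2 * (ln (2 / c) + x) \<le> (2 + 4 * ln (2 / c) + 2) * x"
        using x by (simp add: algebra_simps)
      have "2 * (12 / c + 3)\<^sup>2 * 1 \<le> 2 * (12 / c + 3)\<^sup>2 * (2 * x)"
        using x by (intro mult_left_mono) auto
      then show "2 * (12 / c + 3)\<^sup>2 \<le> 4 * (12 / c + 3)\<^sup>2 * x" by simp
    qed (use c in auto)
    also have "\<dots> = C * ln (real M)"
      by (simp add: C_def x_def distrib_right)
    finally show "?V \<le> C * ln (real M)" .
  qed
  show ?thesis
    using c0(1) \<open>C > 0\<close> main by blast
qed

end
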